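(* Let $\mathcal{D}$ be a datum of Cartan type $A_n$ and let $\mu\in\mathbf{k}^{\Phi^+}$ satisfy (R2) for $\mathcal{D}$. Then: (1) $u^{\mathcal{D}^{\sigma}}_{ij}(\sigma^{\mathcal{D}}(\mu))=(x_{\widetilde{i}\,\widetilde{j}})^N$ in $u(\mathcal{D},\mu)$ for all $1\le i<j\le n+1$. (2) The family $\sigma^{\mathcal{D}}(\mu)$ satisfies (R2) for $\mathcal{D}^{\sigma}$, and $\sigma^{\mathcal{D}^{\sigma}}(\sigma^{\mathcal{D}}(\mu))=\mu$.
   Context: $\mathbf{k}$ is an algebraically closed field of characteristic $0$. Let $n\ge 2$ and let $(a_{ij})_{1\le i,j\le n}$ be the Cartan matrix of type $A_n$: $a_{ii}=2$, $a_{ij}=-1$ if $|i-j|=1$, $a_{ij}=0$ if $|i-j|>1$. A datum of Cartan type $A_n$, $\mathcal{D}$, consists of a finite abelian group $\Gamma$, elements $g_1,\dots,g_n\in\Gamma$ and characters $\chi_1,\dots,\chi_n:\Gamma\to\mathbf{k}^\times$ such that, with $q_{ij}=\chi_j(g_i)$, there is a root of unity $q\in\mathbf{k}$ of order $N>1$, with $N$ odd, such that $q_{ii}=q$ for all $i$, $q_{ij}q_{ji}=q^{-1}$ if $|i-j|=1$, and $q_{ij}q_{ji}=1$ if $|i-j|>1$. Let $\sigma(i)=n-i+1$ for $1\le i\le n$; $\mathcal{D}^\sigma$ is the datum with the same $\Gamma$ and with $g_i^\sigma=g_{\sigma(i)}$, $\chi_i^\sigma=\chi_{\sigma(i)}$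 (same $q$, $N$). For $1\le i<j\le n+1$ put $g_{ij}=\prod_{i\le l<j}g_l$, $\chi_{ij}=\prod_{i\le l<j}\chi_l$. $\mathbf{k}^{\Phi^+}$ is the set of families $\mu=(\mu_{ij})_{1\le i<j\le n+1}$ in $\mathbf{k}$. Condition (R2) for $\mathcal{D}$: $\mu_{ij}=0$ whenever $\chi_{ij}^N\ne1$ (for $\mathcal{D}^\sigma$ use $\chi^\sigma_l$ in place of $\chi_l$). Let $I_{ij}=\{(i_1,\dots,i_r)\mid r\ge2,\ i=i_1<i_2<\dots<i_r=j\}$, $\mu(i_1,\dots,i_r)=\mu_{i_1i_2}\cdots\mu_{i_{r-1}i_r}$, and $$u^{\mathcal{D}}_{ij}(\mu)=\sum_{(i_1,\dots,i_r)\in I_{ij}}(q-1)^{N(r-2)}\mu(i_1,\dots,i_r)\,(1-g_{i_{r-1}i_r}^N)\in\mathbf{k}[\Gamma].$$ Put $\widetilde{i}=n-i+2$ for $1\le i\le n+1$ and $\tau_{ij}=\prod_{i\le k<l<j}q_{lk}^N$ for $i<j$. Then $\sigma^{\mathcal{D}}(\mu)=(\sigma^{\mathcal{D}}_{ij}(\mu))_{1\le i<j\le n+1}$ with $$\sigma^{\mathcal{D}}_{ij}(\mu)=\tau_{\widetilde{j}\,\widetilde{i}}\,(-1)^{j-i+1}\sum_{(i_1,\dots,i_r)\in I_{ij}}(q-1)^{N(r-2)}\mu(\widetilde{i_r},\dots,\widetilde{i_1}).$$ The objects $u^{\mathcal{D}^\sigma}_{ij}$ and $\sigma^{\mathcal{D}^\sigma}$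 are defined by the same formulas with $g_i,\chi_i,q_{ij}$ replaced by those of $\mathcal{D}^\sigma$. For $\mu$ satisfying (R2), $u(\mathcal{D},\mu)$ is the Hopf algebra generated as an algebra by the group $\Gamma$ (with the relations of $\Gamma$) and $x_1,\dots,x_n$, with relations: $gx_ig^{-1}=\chi_i(g)x_i$; $\mathrm{ad}_c(x_i)^{1-a_{ij}}(x_j)=0$ for $i\ne j$, where $\mathrm{ad}_c(x_i)(x_{j_1}\cdots x_{j_s})=x_ix_{j_1}\cdots x_{j_s}-q_{ij_1}\cdots q_{ij_s}x_{j_1}\cdots x_{j_s}x_i$; and $x_{ij}^N=u^{\mathcal{D}}_{ij}(\mu)$ for $1\le i<j\le n+1$, where the root vectors are $x_{i,i+1}=x_i$ and $x_{ij}=x_ix_{i+1,j}-\chi_{i+1,j}(g_i)\,x_{i+1,j}x_i$ for $j-i>1$. Comultiplication: $\Delta(x_i)=g_i\otimes x_i+x_i\otimes1$, $\Delta(g)=g\otimes g$. For $1\le i<j\le n+1$ the reverse root vectors $x_{ji}$ (in $u(\mathcal{D},\mu)$) are $x_{i+1,i}=x_i$ and $x_{ji}=x_{j-1}x_{j-1,i}-\chi_{i,j-1}(g_{j-1})\,x_{j-1,i}x_{j-1}$ for $j-i>1$; note that $\widetilde{i}>\widetilde{j}$ when $i<j$. *)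

theory Defs
  imports
    "HOL-Algebra.QuotRing"
    "HOL-Computational_Algebra.Polynomial"
    "HOL-Library.Poly_Mapping"
begin

section \<open>Free associative algebras\<close>

text \<open>
  The wrapper type makes concatenation of words the addition of a \<^class>\<open>monoid_add\<close>, so that
  \<open>'x word \<Rightarrow>\<^sub>0 'k\<close> is the free associative unital \<open>'k\<close>-algebra on the type \<open>'x\<close>.
\<close>

datatype 'x word = Word (letters: "'x list")

instantiation word :: (type) monoid_add
begin

definition zero_word :: "'x word" where
  "zero_word = Word []"

definition plus_word :: "'x word \<Rightarrow> 'x word \<Rightarrow> 'x word" where
  "plus_word v w = Word (letters v @ letters w)"

instance
  by standard (auto simp: zero_word_def plus_word_def)

end

definition free_algebra :: "'x set \<Rightarrow> ('x word \<Rightarrow>\<^sub>0 'k::field) ring" where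
  "free_algebra X =
     \<lparr>carrier = {p. \<forall>w\<in>Poly_Mapping.keys p. set (letters w) \<subseteq> X},
      monoid.mult = (*), one = 1, zero = 0, add = (+)\<rparr>"

abbreviation scal :: "'k::field \<Rightarrow> ('x word \<Rightarrow>\<^sub>0 'k)" where
  "scal c \<equiv> Poly_Mapping.single 0 c"

lemma free_algebra_sel [simp]:
  "monoid.mult (free_algebra X) = (*)" "one (free_algebra X) = 1"
  "zero (free_algebra X) = 0" "add (free_algebra X) = (+)"
  by (simp_all add: free_algebra_def)

lemma carrier_free_algebra:
  "p \<in> carrier (free_algebra X) \<longleftrightarrow> (\<forall>w\<in>Poly_Mapping.keys p. set (letters w) \<subseteq> X)"
  by (simp add: free_algebra_def)

lemma free_algebra_add:
  "p + r \<in> carrier (free_algebra X)"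
  if "p \<in> carrier (free_algebra X)" "r \<in> carrier (free_algebra X)"
  using that Poly_Mapping.keys_add[of p r] by (auto simp: carrier_free_algebra)

lemma free_algebra_uminus:
  "- p \<in> carrier (free_algebra X)" if "p \<in> carrier (free_algebra X)"
  using that by (simp add: carrier_free_algebra)

lemma free_algebra_diff:
  "p - r \<in> carrier (free_algebra X)"
  if "p \<in> carrier (free_algebra X)" "r \<in> carrier (free_algebra X)"
  using free_algebra_add[OF that(1) free_algebra_uminus[OF that(2)]] by simp

lemma free_algebra_mult:
  "p * r \<in> carrier (free_algebra X)"
  if "p \<in> carrier (free_algebra X)" "r \<in> carrier (free_algebra X)"
proof -
  have "set (letters w) \<subseteq> X" if w: "w \<in> Poly_Mapping.keys (p * r)" for w
  proof -
    from w keys_mult[of p r] obtain a b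
      where "w = a + b" "a \<in> Poly_Mapping.keys p" "b \<in> Poly_Mapping.keys r"
      by blast
    then show ?thesis
      using \<open>p \<in> _\<close> \<open>r \<in> _\<close> by (auto simp: carrier_free_algebra plus_word_def)
  qed
  then show ?thesis
    by (simp add: carrier_free_algebra)
qed

lemma free_algebra_single:
  "Poly_Mapping.single w c \<in> carrier (free_algebra X)" if "set (letters w) \<subseteq> X"
  using that by (auto simp: carrier_free_algebra)

lemma free_algebra_const: "scal c \<in> carrier (free_algebra X)"
  by (rule free_algebra_single) (simp add: zero_word_def)

lemma free_algebra_one: "1 \<in> carrier (free_algebra X)"
  using free_algebra_const[of 1 X] by simp

lemma free_algebra_zero: "0 \<in> carrier (free_algebra X)"
  by (simp add: carrier_free_algebra)

lemma free_algebra_sum: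
  "sum f A \<in> carrier (free_algebra X)" if "\<And>a. a \<in> A \<Longrightarrow> f a \<in> carrier (free_algebra X)"
  using that
  by (induction A rule: infinite_finite_induct) (auto intro: free_algebra_add free_algebra_zero)

lemma free_algebra_power:
  "p ^ m \<in> carrier (free_algebra X)" if "p \<in> carrier (free_algebra X)"
  using that by (induction m) (auto intro: free_algebra_one free_algebra_mult)

lemma ring_free_algebra: "ring (free_algebra X)"
proof (rule ringI)
  show "abelian_group (free_algebra X)"
  proof (rule abelian_groupI)
    fix p assume "p \<in> carrier (free_algebra X)"
    then show "\<exists>r\<in>carrier (free_algebra X). r \<oplus>\<^bsub>free_algebra X\<^esub> p = \<zero>\<^bsub>free_algebra X\<^esub>"
      by (intro bexI[of _ "- p"]) (auto intro: free_algebra_uminus)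
  qed (auto intro: free_algebra_add free_algebra_zero simp: algebra_simps)
  show "monoid (free_algebra X)"
    by (rule monoidI) (auto intro: free_algebra_mult free_algebra_one simp: algebra_simps)
qed (auto simp: algebra_simps)


section \<open>Data of Cartan type \<open>A\<^sub>n\<close>\<close>

text \<open>
  Indices are \<^typ>\<open>nat\<close>; only \<open>elt D i\<close>, \<open>chr D i\<close> with \<open>1 \<le> i \<le> n\<close> and \<open>\<mu> i j\<close> with
  \<open>1 \<le> i < j \<le> n + 1\<close> carry meaning.  The root of unity \<open>q\<close> and its order \<open>N\<close>
  are recorded in the datum; they are determined by the remaining components.
\<close>

record ('g, 'k) datum =
  grp :: "'g monoid"
  elt :: "nat \<Rightarrow> 'g"
  chr :: "nat \<Rightarrow> 'g \<Rightarrow> 'k"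
  par :: 'k
  ordr :: nat

definition cartan_matrix :: "nat \<Rightarrow> nat \<Rightarrow> int" where
  "cartan_matrix i j = (if i = j then 2 else if i = Suc j \<or> j = Suc i then -1 else 0)"

definition mult_group_of_field :: "'k::field monoid" where
  "mult_group_of_field = \<lparr>carrier = UNIV - {0}, monoid.mult = (*), one = 1\<rparr>"

definition qq :: "('g, 'k) datum \<Rightarrow> nat \<Rightarrow> nat \<Rightarrow> 'k" where
  "qq D i j = chr D j (elt D i)"

definition datum_type_A :: "nat \<Rightarrow> ('g, 'k::field) datum \<Rightarrow> bool" where
  "datum_type_A n D \<longleftrightarrow>
     comm_group (grp D) \<and> finite (carrier (grp D)) \<and>
     (\<forall>i\<in>{1..n}. elt D i \<in> carrier (grp D)) \<and>
     (\<forall>i\<in>{1..n}. chr D i \<in> hom (grp D) mult_group_of_field) \<and>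
     ordr D > 1 \<and> odd (ordr D) \<and>
     par D ^ ordr D = 1 \<and> (\<forall>m. 0 < m \<and> m < ordr D \<longrightarrow> par D ^ m \<noteq> 1) \<and>
     (\<forall>i\<in>{1..n}. qq D i i = par D) \<and>
     (\<forall>i\<in>{1..n}. \<forall>j\<in>{1..n}. i = Suc j \<or> j = Suc i \<longrightarrow> qq D i j * qq D j i = inverse (par D)) \<and>
     (\<forall>i\<in>{1..n}. \<forall>j\<in>{1..n}. Suc i < j \<or> Suc j < i \<longrightarrow> qq D i j * qq D j i = 1)"

definition sigma_datum :: "nat \<Rightarrow> ('g, 'k) datum \<Rightarrow> ('g, 'k) datum" where
  "sigma_datum n D =
     D\<lparr>elt := (\<lambda>i. elt D (n + 1 - i)), chr := (\<lambda>i. chr D (n + 1 - i))\<rparr>"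

definition elt_root :: "('g, 'k) datum \<Rightarrow> nat \<Rightarrow> nat \<Rightarrow> 'g" where
  "elt_root D i j = finprod (grp D) (elt D) {i..<j}"

definition chr_root :: "('g, 'k::field) datum \<Rightarrow> nat \<Rightarrow> nat \<Rightarrow> 'g \<Rightarrow> 'k" where
  "chr_root D i j h = (\<Prod>l\<in>{i..<j}. chr D l h)"

definition R2 :: "nat \<Rightarrow> ('g, 'k::field) datum \<Rightarrow> (nat \<Rightarrow> nat \<Rightarrow> 'k) \<Rightarrow> bool" where
  "R2 n D \<mu> \<longleftrightarrow>
     (\<forall>i j. 1 \<le> i \<and> i < j \<and> j \<le> n + 1 \<and>
        \<not> (\<forall>h\<in>carrier (grp D). chr_root D i j h ^ ordr D = 1) \<longrightarrow> \<mu> i j = 0)"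


section \<open>The families \<open>u\<^sub>i\<^sub>j(\<mu>)\<close> and \<open>\<sigma>(\<mu>)\<close>\<close>

definition chains :: "nat \<Rightarrow> nat \<Rightarrow> nat list set" where
  "chains i j = {c. 2 \<le> length c \<and> sorted_wrt (<) c \<and> hd c = i \<and> last c = j}"

definition chain_prod :: "(nat \<Rightarrow> nat \<Rightarrow> 'k::field) \<Rightarrow> nat list \<Rightarrow> 'k" where
  "chain_prod \<mu> c = (\<Prod>s<length c - 1. \<mu> (c ! s) (c ! Suc s))"

lemma finite_chains: "finite (chains i j)"
proof (rule finite_subset)
  show "finite {c. set c \<subseteq> {..j} \<and> length c \<le> Suc j}"
    by (rule finite_lists_length_le) simp
  have "set c \<subseteq> {..j} \<and> length c \<le> Suc j" if "c \<in> chains i j" for c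
  proof -
    from that have ne: "c \<noteq> []" and s: "sorted_wrt (<) c" and l: "last c = j"
      by (auto simp: chains_def)
    have "x \<le> last c" if "x \<in> set c" for x
    proof -
      have "sorted_wrt (<) (butlast c @ [last c])"
        using s ne by simp
      moreover have "x \<in> set (butlast c @ [last c])"
        using that ne by simp
      ultimately show ?thesis
        by (auto simp: sorted_wrt_append intro: less_imp_le)
    qed
    then have sub: "set c \<subseteq> {..j}"
      using l by auto
    have "length c = card (set c)"
      using s strict_sorted_iff distinct_card by metis
    also have "\<dots> \<le> card {..j}"
      using sub by (intro card_mono) auto
    finally show ?thesis
      using sub by simp
  qed
  then show "chains i j \<subseteq> {c. set c \<subseteq> {..j} \<and> length c \<le> Suc j}"
    by blast
qed

text \<open>
  An element of the group algebra of \<open>\<Gamma>\<close> is given by its coefficients, as a finitely supported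
  function on \<open>\<Gamma>\<close>; thus \<open>c(1 - h)\<close> is \<open>single \<one> c - single h c\<close>.  The entry
  \<open>c ! (length c - 2)\<close> is \<open>i\<^bsub>r-1\<^esub>\<close>.
\<close>

definition u_elem ::
  "('g, 'k::field) datum \<Rightarrow> (nat \<Rightarrow> nat \<Rightarrow> 'k) \<Rightarrow> nat \<Rightarrow> nat \<Rightarrow> ('g \<Rightarrow>\<^sub>0 'k)" where
  "u_elem D \<mu> i j =
     (\<Sum>c\<in>chains i j.
        let a = (par D - 1) ^ (ordr D * (length c - 2)) * chain_prod \<mu> c;
            h = elt_root D (c ! (length c - 2)) (last c) [^]\<^bsub>grp D\<^esub> ordr D
        in Poly_Mapping.single \<one>\<^bsub>grp D\<^esub> a - Poly_Mapping.single h a)"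

definition tilde :: "nat \<Rightarrow> nat \<Rightarrow> nat" where
  "tilde n i = n + 2 - i"

definition tau :: "('g, 'k::field) datum \<Rightarrow> nat \<Rightarrow> nat \<Rightarrow> 'k" where
  "tau D i j = (\<Prod>(k, l)\<in>{(k, l). i \<le> k \<and> k < l \<and> l < j}. qq D l k ^ ordr D)"

definition sigma_fam ::
  "nat \<Rightarrow> ('g, 'k::field) datum \<Rightarrow> (nat \<Rightarrow> nat \<Rightarrow> 'k) \<Rightarrow> nat \<Rightarrow> nat \<Rightarrow> 'k" where
  "sigma_fam n D \<mu> i j =
     tau D (tilde n j) (tilde n i) * (- 1) ^ (j - i + 1) *
     (\<Sum>c\<in>chains i j.
        (par D - 1) ^ (ordr D * (length c - 2)) * chain_prod \<mu> (rev (map (tilde n) c)))"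


section \<open>The algebra \<open>u(\<D>, \<mu>)\<close>\<close>

datatype 'g gen = Grp 'g | Var nat

definition gens :: "nat \<Rightarrow> ('g, 'k) datum \<Rightarrow> 'g gen set" where
  "gens n D = Grp ` carrier (grp D) \<union> Var ` {1..n}"

abbreviation grp_gen :: "'g \<Rightarrow> ('g gen word \<Rightarrow>\<^sub>0 'k::field)" where
  "grp_gen h \<equiv> Poly_Mapping.single (Word [Grp h]) 1"

abbreviation var_gen :: "nat \<Rightarrow> ('g gen word \<Rightarrow>\<^sub>0 'k::field)" where
  "var_gen i \<equiv> Poly_Mapping.single (Word [Var i]) 1"

definition of_group_algebra :: "('g \<Rightarrow>\<^sub>0 'k::field) \<Rightarrow> ('g gen word \<Rightarrow>\<^sub>0 'k)" where
  "of_group_algebra p = (\<Sum>h\<in>Poly_Mapping.keys p. scal (Poly_Mapping.lookup p h) * grp_gen h)"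

text \<open>
  \<open>braiding D i w = q\<^bsub>i j\<^sub>1\<^esub> \<cdots> q\<^bsub>i j\<^sub>s\<^esub>\<close> for \<open>w = x\<^bsub>j\<^sub>1\<^esub> \<cdots> x\<^bsub>j\<^sub>s\<^esub>\<close>.  Letters from
  \<open>\<Gamma>\<close> get weight \<open>1\<close>; they never occur in the words to which \<open>ad_c\<close> is applied below.
  The map \<open>ad_c D i\<close> is the linear extension from words of
  \<open>w \<mapsto> x\<^sub>i w - q\<^bsub>i j\<^sub>1\<^esub> \<cdots> q\<^bsub>i j\<^sub>s\<^esub> w x\<^sub>i\<close>.
\<close>

definition braiding :: "('g, 'k::field) datum \<Rightarrow> nat \<Rightarrow> 'g gen word \<Rightarrow> 'k" where
  "braiding D i w =
     prod_list (map (\<lambda>a. case a of Var j \<Rightarrow> qq D i j | Grp _ \<Rightarrow> 1) (letters w))"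

definition ad_c ::
  "('g, 'k::field) datum \<Rightarrow> nat \<Rightarrow> ('g gen word \<Rightarrow>\<^sub>0 'k) \<Rightarrow> ('g gen word \<Rightarrow>\<^sub>0 'k)" where
  "ad_c D i p =
     (\<Sum>w\<in>Poly_Mapping.keys p.
        scal (Poly_Mapping.lookup p w) *
          (var_gen i * Poly_Mapping.single w 1 - scal (braiding D i w) * Poly_Mapping.single w 1 * var_gen i))"

text \<open>
  \<open>root_vec D i j\<close> is \<open>x\<^sub>i\<^sub>j\<close> and \<open>rev_root_vec D j i\<close> is \<open>x\<^sub>j\<^sub>i\<close>, for \<open>i < j\<close>.
\<close>

function root_vec :: "('g, 'k::field) datum \<Rightarrow> nat \<Rightarrow> nat \<Rightarrow> ('g gen word \<Rightarrow>\<^sub>0 'k)" where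
  "root_vec D i j =
     (if j \<le> Suc i then var_gen i
      else var_gen i * root_vec D (Suc i) j
             - scal (chr_root D (Suc i) j (elt D i)) * root_vec D (Suc i) j * var_gen i)"
  by auto
termination
  by (relation "measure (\<lambda>(D, i, j). j - i)") auto

function rev_root_vec :: "('g, 'k::field) datum \<Rightarrow> nat \<Rightarrow> nat \<Rightarrow> ('g gen word \<Rightarrow>\<^sub>0 'k)" where
  "rev_root_vec D j i =
     (if j \<le> Suc i then var_gen i
      else var_gen (j - 1) * rev_root_vec D (j - 1) i
             - scal (chr_root D i (j - 1) (elt D (j - 1))) * rev_root_vec D (j - 1) i * var_gen (j - 1))"
  by auto
termination
  by (relation "measure (\<lambda>(D, j, i). j - i)") auto

declare root_vec.simps [simp del] rev_root_vec.simps [simp del]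

text \<open>
  Each element \<open>r\<close> of \<open>relators\<close> stands for the relation \<open>r = 0\<close>.  Only the algebra underlying
  the Hopf algebra \<open>u(\<D>, \<mu>)\<close> is constructed: its coalgebra structure does not enter
  identities between elements.
\<close>

definition relators ::
  "nat \<Rightarrow> ('g, 'k::field) datum \<Rightarrow> (nat \<Rightarrow> nat \<Rightarrow> 'k) \<Rightarrow> ('g gen word \<Rightarrow>\<^sub>0 'k) set" where
  "relators n D \<mu> =
     {grp_gen \<one>\<^bsub>grp D\<^esub> - 1} \<union>
     {grp_gen g * grp_gen h - grp_gen (g \<otimes>\<^bsub>grp D\<^esub> h) |g h. g \<in> carrier (grp D) \<and> h \<in> carrier (grp D)} \<union>
     {grp_gen g * var_gen i * grp_gen (inv\<^bsub>grp D\<^esub> g) - scal (chr D i g) * var_gen i |g i.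
        g \<in> carrier (grp D) \<and> i \<in> {1..n}} \<union>
     {(ad_c D i ^^ nat (1 - cartan_matrix i j)) (var_gen j) |i j.
        i \<in> {1..n} \<and> j \<in> {1..n} \<and> i \<noteq> j} \<union>
     {root_vec D i j ^ ordr D - of_group_algebra (u_elem D \<mu> i j) |i j.
        1 \<le> i \<and> i < j \<and> j \<le> n + 1}"

definition rel_ideal ::
  "nat \<Rightarrow> ('g, 'k::field) datum \<Rightarrow> (nat \<Rightarrow> nat \<Rightarrow> 'k) \<Rightarrow> ('g gen word \<Rightarrow>\<^sub>0 'k) set" where
  "rel_ideal n D \<mu> = genideal (free_algebra (gens n D)) (relators n D \<mu>)"

definition u_alg ::
  "nat \<Rightarrow> ('g, 'k::field) datum \<Rightarrow> (nat \<Rightarrow> nat \<Rightarrow> 'k) \<Rightarrow> ('g gen word \<Rightarrow>\<^sub>0 'k) set ring" where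
  "u_alg n D \<mu> = free_algebra (gens n D) Quot rel_ideal n D \<mu>"

definition u_class ::
  "nat \<Rightarrow> ('g, 'k::field) datum \<Rightarrow> (nat \<Rightarrow> nat \<Rightarrow> 'k) \<Rightarrow> ('g gen word \<Rightarrow>\<^sub>0 'k)
     \<Rightarrow> ('g gen word \<Rightarrow>\<^sub>0 'k) set" where
  "u_class n D \<mu> p = rel_ideal n D \<mu> +>\<^bsub>free_algebra (gens n D)\<^esub> p"

text \<open>
  The relators lie in the free algebra on \<^const>\<open>gens\<close>, so \<^const>\<open>rel_ideal\<close> is the two-sided
  ideal they generate and \<^const>\<open>u_class\<close> is the projection onto the quotient ring.
\<close>

lemma var_gen_in: "var_gen i \<in> carrier (free_algebra (gens n D))" if "i \<in> {1..n}"
  using that by (intro free_algebra_single) (auto simp: gens_def)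

lemma grp_gen_in: "grp_gen h \<in> carrier (free_algebra (gens n D))" if "h \<in> carrier (grp D)"
  using that by (intro free_algebra_single) (auto simp: gens_def)

lemma ad_c_in:
  "ad_c D i p \<in> carrier (free_algebra (gens n D))"
  if "i \<in> {1..n}" "p \<in> carrier (free_algebra (gens n D))"
  unfolding ad_c_def using that
  by (intro free_algebra_sum free_algebra_mult free_algebra_diff free_algebra_const var_gen_in
        free_algebra_single) (auto simp: carrier_free_algebra)

lemma root_vec_in:
  "1 \<le> i \<Longrightarrow> i < j \<Longrightarrow> j \<le> n + 1 \<Longrightarrow> root_vec D i j \<in> carrier (free_algebra (gens n D))"
proof (induction D i j rule: root_vec.induct)
  case (1 D i j)
  then show ?case
    by (subst root_vec.simps)
      (auto intro!: free_algebra_mult free_algebra_diff free_algebra_const var_gen_in)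
qed

lemma rev_root_vec_in:
  "1 \<le> i \<Longrightarrow> i < j \<Longrightarrow> j \<le> n + 1 \<Longrightarrow> rev_root_vec D j i \<in> carrier (free_algebra (gens n D))"
proof (induction D j i rule: rev_root_vec.induct)
  case (1 D j i)
  then show ?case
    by (subst rev_root_vec.simps)
      (auto intro!: free_algebra_mult free_algebra_diff free_algebra_const var_gen_in)
qed

lemma of_group_algebra_in:
  "of_group_algebra p \<in> carrier (free_algebra (gens n D))"
  if "Poly_Mapping.keys p \<subseteq> carrier (grp D)"
  unfolding of_group_algebra_def using that
  by (intro free_algebra_sum free_algebra_mult free_algebra_const grp_gen_in) auto

lemma keys_sum_subset:
  "Poly_Mapping.keys (sum f A) \<subseteq> B" if "\<And>a. a \<in> A \<Longrightarrow> Poly_Mapping.keys (f a) \<subseteq> B"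
  using that Poly_Mapping.keys_sum[of f A] by blast

lemma u_elem_keys:
  assumes D: "datum_type_A n D" and ij: "1 \<le> i" "i < j" "j \<le> n + 1"
  shows "Poly_Mapping.keys (u_elem D \<mu> i j) \<subseteq> carrier (grp D)"
  unfolding u_elem_def Let_def
proof (rule keys_sum_subset)
  fix c assume c: "c \<in> chains i j"
  interpret comm_group "grp D"
    using D by (simp add: datum_type_A_def)
  let ?k = "c ! (length c - 2)"
  from c have len: "2 \<le> length c" and s: "sorted_wrt (<) c" and h: "hd c = i" and l: "last c = j"
    by (auto simp: chains_def)
  have "c ! 0 = i"
    using h len by (metis hd_conv_nth le_zero_eq list.size(3) zero_neq_numeral)
  then have "i \<le> ?k"
    using sorted_wrt_nth_less[OF s, of 0 "length c - 2"] len
    by (cases "length c = 2") (simp_all add: less_imp_le)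
  then have "elt D \<in> {?k..<j} \<rightarrow> carrier (grp D)"
    using D ij by (auto simp: datum_type_A_def)
  then have "elt_root D ?k (last c) \<in> carrier (grp D)"
    unfolding elt_root_def l by (rule finprod_closed)
  then have "elt_root D ?k (last c) [^]\<^bsub>grp D\<^esub> ordr D \<in> carrier (grp D)"
    by simp
  moreover have "Poly_Mapping.keys (Poly_Mapping.single a s - Poly_Mapping.single b t) \<subseteq> {a, b}"
    for a b and s t :: 'b
    using keys_diff[of "Poly_Mapping.single a s" "Poly_Mapping.single b t"]
    by (auto split: if_splits)
  ultimately show "Poly_Mapping.keys
      (Poly_Mapping.single \<one>\<^bsub>grp D\<^esub> ((par D - 1) ^ (ordr D * (length c - 2)) * chain_prod \<mu> c) -
       Poly_Mapping.single (elt_root D ?k (last c) [^]\<^bsub>grp D\<^esub> ordr D)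
         ((par D - 1) ^ (ordr D * (length c - 2)) * chain_prod \<mu> c)) \<subseteq> carrier (grp D)"
    by (meson empty_subsetI insert_subset one_closed order_trans)
qed

lemma relators_in:
  assumes D: "datum_type_A n D"
  shows "relators n D \<mu> \<subseteq> carrier (free_algebra (gens n D))"
proof -
  interpret comm_group "grp D"
    using D by (simp add: datum_type_A_def)
  have "(ad_c D i ^^ m) (var_gen j) \<in> carrier (free_algebra (gens n D))"
    if "i \<in> {1..n}" "j \<in> {1..n}" for i j m
    using that by (induction m) (simp_all add: var_gen_in ad_c_in del: atLeastAtMost_iff)
  moreover have "of_group_algebra (u_elem D \<mu> i j) \<in> carrier (free_algebra (gens n D))"
    if "1 \<le> i" "i < j" "j \<le> n + 1" for i j
    by (rule of_group_algebra_in[OF u_elem_keys[OF D that]])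
  ultimately show ?thesis
    unfolding relators_def
    by (auto intro!: free_algebra_diff free_algebra_mult free_algebra_one free_algebra_const
        free_algebra_power grp_gen_in var_gen_in root_vec_in)
qed

lemma ideal_rel_ideal:
  "ideal (rel_ideal n D \<mu>) (free_algebra (gens n D))" if "datum_type_A n D"
  unfolding rel_ideal_def
  by (rule ring.genideal_ideal[OF ring_free_algebra relators_in[OF that]])

lemma u_class_hom:
  "u_class n D \<mu> \<in> ring_hom (free_algebra (gens n D)) (u_alg n D \<mu>)" if "datum_type_A n D"
  unfolding u_class_def[abs_def] u_alg_def
  by (rule ideal.rcos_ring_hom[OF ideal_rel_ideal[OF that]])

end

theory Submission
  imports Defs
begin

text \<open>
  Write \<open>[u, v]\<close> for braided commutators.  For \<open>i < k < j\<close> put \<open>a = x\<^sub>i\<^sub>k\<close> and \<open>b = x\<^sub>j\<^sub>k\<close> (a reverse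
  root vector).  They satisfy the quantum Serre relations of type \<open>A\<^sub>2\<close>, and with
  \<open>A = [a, b]\<close>, \<open>W = [b, a]\<close> a computation with commuting elements gives
  \<open>W\<^sup>N = (q - 1)\<^sup>N \<kappa> b\<^sup>N a\<^sup>N - \<beta>\<^sup>N A\<^sup>N\<close>.  Since \<open>[x\<^sub>i\<^sub>k, x\<^sub>j\<^sub>k]\<close> is a multiple of
  \<open>[x\<^sub>j\<^sub>,\<^sub>k\<^sub>+\<^sub>1, x\<^sub>i\<^sub>,\<^sub>k\<^sub>+\<^sub>1]\<close>, these relations telescope from \<open>x\<^sub>j\<^sub>i = [x\<^sub>j\<^sub>,\<^sub>i\<^sub>+\<^sub>1, x\<^sub>i]\<close> to
  \<open>x\<^sub>i\<^sub>j = [x\<^sub>i\<^sub>,\<^sub>j\<^sub>-\<^sub>1, x\<^sub>j\<^sub>-\<^sub>1]\<close> and express \<open>x\<^sub>j\<^sub>i\<^sup>N\<close> recursively by the \<open>x\<^sub>j\<^sub>k\<^sup>N\<close> and the \<open>x\<^sub>i\<^sub>k\<^sup>N\<close>.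

  The rest is matrix algebra over \<open>k[\<Gamma>]\<close>.  Let \<open>s = (q - 1)\<^sup>N\<close>, let \<open>T = 1 - s \<mu>\<close> be unitriangular
  and let \<open>g\<close> be diagonal with entries \<open>g\<^sub>1\<^sub>i\<^sup>N\<close>; then \<open>1 + s u(\<mu>) = T\<^sup>-\<^sup>1 g\<^sup>-\<^sup>1 T g\<close>.
  By (R2) the twist by \<open>\<tau>\<close> is multiplicative wherever it matters, so up to the signs and \<open>\<tau>\<close> passing
  from \<open>\<mu>\<close> to \<open>\<sigma>(\<mu>)\<close> replaces \<open>T\<close> by the antitranspose of \<open>T\<^sup>-\<^sup>1\<close>.  Hence \<open>\<sigma>\<close> is an involution,
  and both sides of (1) solve the same recursion.
\<close>

section \<open>Computations modulo a two-sided ideal\<close>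

lemma degree_linear_prod_le: "degree (\<Prod>i<m. [:1, t i:]) \<le> m"
proof -
  have "degree (\<Prod>i<m. [:1, t i:]) \<le> (\<Sum>i<m. degree [:1, t i:])"
    using degree_prod_sum_le[of "{..<m}" "\<lambda>i. [:1, t i:]"] by (simp only: finite_lessThan comp_def)
  also have "\<dots> \<le> (\<Sum>i<m. 1)"
    by (rule sum_mono) simp
  finally show ?thesis
    by simp
qed

text \<open>All computations use representatives in a type-class ring, modulo a two-sided ideal, so
  that ordinary ring simplification applies; cosets return only at the very end.\<close>

locale algebra_ideal =
  fixes scl :: "'k::field \<Rightarrow> 'r::ring_1 \<Rightarrow> 'r" (infixr "\<cdot>" 75)
    and I :: "'r set"
  assumes scl_add: "c \<cdot> (x + y) = c \<cdot> x + c \<cdot> y"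
    and add_scl: "(c + d) \<cdot> x = c \<cdot> x + d \<cdot> x"
    and scl_scl: "c \<cdot> (d \<cdot> x) = (c * d) \<cdot> x"
    and scl_one: "1 \<cdot> x = x"
    and scl_mult: "(c \<cdot> x) * y = c \<cdot> (x * y)"
    and mult_scl: "x * (c \<cdot> y) = c \<cdot> (x * y)"
    and ideal_zero: "0 \<in> I"
    and ideal_add: "x \<in> I \<Longrightarrow> y \<in> I \<Longrightarrow> x + y \<in> I"
    and ideal_mult_left: "x \<in> I \<Longrightarrow> y * x \<in> I"
    and ideal_mult_right: "x \<in> I \<Longrightarrow> x * y \<in> I"
begin

lemma scl_zero_right: "c \<cdot> 0 = 0"
  using scl_add[of c 0 0] by simp

lemma scl_zero_left: "0 \<cdot> x = 0"
  using add_scl[of 0 0 x] by simp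

lemma scl_minus: "c \<cdot> (- x) = - (c \<cdot> x)"
  using scl_add[of c x "- x"] by (simp add: scl_zero_right add_eq_0_iff2)

lemma minus_scl: "(- c) \<cdot> x = - (c \<cdot> x)"
  using add_scl[of c "- c" x] by (simp add: scl_zero_left add_eq_0_iff)

lemma scl_diff: "c \<cdot> (x - y) = c \<cdot> x - c \<cdot> y"
  using scl_add[of c x "- y"] by (simp add: scl_minus)

lemma diff_scl: "(c - d) \<cdot> x = c \<cdot> x - d \<cdot> x"
  using add_scl[of c "- d" x] by (simp add: minus_scl)

lemma scl_sum: "c \<cdot> sum f A = (\<Sum>a\<in>A. c \<cdot> f a)"
  by (induction A rule: infinite_finite_induct) (auto simp: scl_add scl_zero_right)

lemma sum_scl: "sum f A \<cdot> x = (\<Sum>a\<in>A. f a \<cdot> x)"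
  by (induction A rule: infinite_finite_induct) (auto simp: add_scl scl_zero_left)

lemma scl_power: "(c \<cdot> x) ^ m = c ^ m \<cdot> x ^ m"
  by (induction m) (auto simp: scl_one scl_mult mult_scl scl_scl mult.commute)

lemmas scl_simps = scl_add add_scl scl_scl scl_mult mult_scl scl_minus minus_scl scl_diff diff_scl

lemma ideal_scl: "x \<in> I \<Longrightarrow> c \<cdot> x \<in> I"
  using ideal_mult_left[of x "c \<cdot> 1"] by (simp add: scl_mult)

lemma ideal_minus: "x \<in> I \<Longrightarrow> - x \<in> I"
  using ideal_mult_left[of x "- 1"] by simp

lemma ideal_diff: "x \<in> I \<Longrightarrow> y \<in> I \<Longrightarrow> x - y \<in> I"
  using ideal_add[OF _ ideal_minus, of x y] by simp

lemma ideal_sum: "(\<And>a. a \<in> A \<Longrightarrow> f a \<in> I) \<Longrightarrow> sum f A \<in> I"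
  by (induction A rule: infinite_finite_induct) (auto intro: ideal_zero ideal_add)

lemmas ideal_intros =
  ideal_add ideal_diff ideal_minus ideal_scl ideal_mult_left ideal_mult_right

section \<open>Congruence modulo the ideal\<close>

definition eqv :: "'r \<Rightarrow> 'r \<Rightarrow> bool" (infix "\<approx>" 50) where
  "x \<approx> y \<longleftrightarrow> x - y \<in> I"

lemma eqv_refl [simp, intro]: "x \<approx> x"
  by (simp add: eqv_def ideal_zero)

lemma eqv_sym: "x \<approx> y \<Longrightarrow> y \<approx> x"
  using ideal_minus[of "x - y"] by (simp add: eqv_def)

lemma eqv_trans [trans]: "x \<approx> y \<Longrightarrow> y \<approx> z \<Longrightarrow> x \<approx> z"
  using ideal_add[of "x - y" "y - z"] by (simp add: eqv_def)

lemma eq_eqv_trans [trans]: "x = y \<Longrightarrow> y \<approx> z \<Longrightarrow> x \<approx> z"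
  and eqv_eq_trans [trans]: "x \<approx> y \<Longrightarrow> y = z \<Longrightarrow> x \<approx> z"
  by simp_all

lemma eqv_add: "x \<approx> x' \<Longrightarrow> y \<approx> y' \<Longrightarrow> x + y \<approx> x' + y'"
  using ideal_add[of "x - x'" "y - y'"] by (simp add: eqv_def algebra_simps)

lemma eqv_diff: "x \<approx> x' \<Longrightarrow> y \<approx> y' \<Longrightarrow> x - y \<approx> x' - y'"
  using ideal_diff[of "x - x'" "y - y'"] by (simp add: eqv_def algebra_simps)

lemma eqv_scl: "x \<approx> y \<Longrightarrow> c \<cdot> x \<approx> c \<cdot> y"
  using ideal_scl[of "x - y"] by (simp add: eqv_def scl_diff)

lemma eqv_mult:
  assumes "x \<approx> x'" "y \<approx> y'"
  shows "x * y \<approx> x' * y'"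
proof -
  have "x * y - x' * y' = (x - x') * y + x' * (y - y')"
    by (simp add: algebra_simps)
  then show ?thesis
    using assms by (simp add: eqv_def ideal_intros)
qed

lemma eqv_power: "x \<approx> y \<Longrightarrow> x ^ m \<approx> y ^ m"
  by (induction m) (auto intro: eqv_mult)

lemma eqv_sum: "(\<And>a. a \<in> A \<Longrightarrow> f a \<approx> g a) \<Longrightarrow> sum f A \<approx> sum g A"
  using ideal_sum[of A "\<lambda>a. f a - g a"] by (simp add: eqv_def sum_subtractf)

lemma eqv_scl_cancel: "c \<cdot> x \<approx> c \<cdot> y \<Longrightarrow> c \<noteq> 0 \<Longrightarrow> x \<approx> y"
  using eqv_scl[of "c \<cdot> x" "c \<cdot> y" "inverse c"] by (simp add: scl_scl scl_one)

section \<open>Braided commutators and q-commutation\<close>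

definition br :: "'k \<Rightarrow> 'r \<Rightarrow> 'r \<Rightarrow> 'r" where
  "br c x y = x * y - c \<cdot> (y * x)"

definition qcomm :: "'k \<Rightarrow> 'r \<Rightarrow> 'r \<Rightarrow> bool" where
  "qcomm c x y \<longleftrightarrow> br c x y \<in> I"

lemma qcomm_iff: "qcomm c x y \<longleftrightarrow> x * y \<approx> c \<cdot> (y * x)"
  by (simp add: qcomm_def br_def eqv_def)

lemma eqv_br: "x \<approx> x' \<Longrightarrow> y \<approx> y' \<Longrightarrow> br c x y \<approx> br c x' y'"
  unfolding br_def by (intro eqv_diff eqv_mult eqv_scl)

lemma qcomm_cong:
  assumes "x \<approx> x'" "y \<approx> y'"
  shows "qcomm c x y \<longleftrightarrow> qcomm c x' y'"
  using eqv_br[OF assms, of c] eqv_trans eqv_sym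
  unfolding qcomm_def by (metis diff_zero eqv_def)

lemma qcomm_sym:
  assumes "qcomm c x y" "c * d = 1"
  shows "qcomm d y x"
proof -
  have "y * x - d \<cdot> (x * y) = - (d \<cdot> br c x y)"
    using assms(2) by (simp add: br_def scl_simps mult.commute[of d] scl_one)
  then show ?thesis
    using assms(1) by (simp add: qcomm_def br_def[of d] ideal_intros)
qed

lemma qcomm_scl_right: "qcomm c x y \<Longrightarrow> qcomm c x (e \<cdot> y)"
  using ideal_scl[of "br c x y" e] by (simp add: qcomm_def br_def scl_simps mult_ac)

text \<open>Moving \<open>x\<close> past \<open>y\<close> and past \<open>z\<close> multiplies by
  \<open>c\<close> and \<open>d\<close> in either order, so both terms of the bracket acquire the
  same scalar, whatever \<open>e\<close> is.\<close>

lemma qcomm_br_right: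
  assumes "qcomm c x y" "qcomm d x z"
  shows "qcomm (c * d) x (br e y z)"
proof -
  have "br (c * d) x (br e y z) = br c x y * z + c \<cdot> (y * br d x z)
      - e \<cdot> (br d x z * y + d \<cdot> (z * br c x y))"
    by (simp add: br_def scl_simps algebra_simps)
  then show ?thesis
    using assms by (simp add: qcomm_def ideal_intros)
qed

lemma qcomm_br_left:
  assumes "qcomm c x z" "qcomm d y z"
  shows "qcomm (c * d) (br e x y) z"
proof -
  have "br (c * d) (br e x y) z = x * br d y z + d \<cdot> (br c x z * y)
      - e \<cdot> (y * br c x z + c \<cdot> (br d y z * x))"
    by (simp add: br_def scl_simps algebra_simps)
  then show ?thesis
    using assms by (simp add: qcomm_def ideal_intros)
qed

text \<open>Braided Jacobi identity: the two nestings differ only by multiples of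
  \<open>br g x z\<close>, which lies in \<open>I\<close>.\<close>

lemma br_jacobi:
  assumes "qcomm g x z"
  shows "br (c * g) x (br d y z) \<approx> br (d * g) (br c x y) z"
proof -
  have "br (c * g) x (br d y z) - br (d * g) (br c x y) z = c \<cdot> (y * br g x z) - d \<cdot> (br g x z * y)"
    by (simp add: br_def scl_simps algebra_simps)
  then show ?thesis
    using assms by (simp add: qcomm_def eqv_def ideal_intros)
qed

text \<open>The other form of the Jacobi identity: two outer factors that q-commute may be
  interchanged, the error being multiples of \<open>br g a b\<close>.\<close>

lemma br_exchange:
  assumes "qcomm g a b" "g * h = 1"
  shows "br (g * e) a (br d b x) \<approx> g \<cdot> br (d * h) b (br e a x)"
proof -
  have g: "g * (d * h) = d" "d * (g * h) = d" "d * (e * (g * h)) = d * e"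
    using assms(2) by (simp_all add: algebra_simps)
  have "br (g * e) a (br d b x) - g \<cdot> br (d * h) b (br e a x)
      = br g a b * x + (d * e) \<cdot> (x * (- br g a b))"
    by (simp add: br_def scl_simps algebra_simps g scl_one)
  then show ?thesis
    using assms by (simp add: qcomm_def eqv_def ideal_intros)
qed

text \<open>
  The product of the root vectors \<open>br \<alpha> a b\<close> and \<open>br \<beta> b c\<close> is rewritten in two ways; the
  difference is \<open>1 + p\<close> times the claimed relation.
\<close>

lemma qcomm_middle:
  assumes ac: "qcomm \<gamma> a c" and ab: "qcomm (p * \<alpha>) (br \<alpha> a b) b"
    and bc: "qcomm (p * \<beta>) b (br \<beta> b c)" and p: "1 + p \<noteq> 0" and al: "\<alpha> * \<delta> = 1"
  shows "qcomm (\<beta> * \<delta>) b (br (\<beta> * \<gamma>) (br \<alpha> a b) c)"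
proof -
  define A C where "A = br \<alpha> a b" and "C = br \<beta> b c"
  define X where "X = br (\<beta> * \<gamma>) A c"
  have X': "X - br (\<alpha> * \<gamma>) a C \<in> I"
    using eqv_sym[OF br_jacobi[OF ac, of \<alpha> \<beta> b]] by (simp add: A_def C_def X_def eqv_def)
  define Z where "Z = br (\<alpha> * \<gamma>) a C"
  \<comment> \<open>The first rewriting expands \<open>C\<close> and moves \<open>b\<close> past
    \<open>A\<close>; the second expands \<open>A\<close> and moves \<open>b\<close> past
    \<open>C\<close>. So \<open>1\<close> rests on \<open>ab\<close> alone and \<open>2\<close> on
    \<open>bc\<close> alone.\<close>
  have 1: "A * C - ((p * \<alpha>) \<cdot> (b * X) - \<beta> \<cdot> (X * b) + (p * \<alpha> * \<gamma> * \<beta>) \<cdot> (C * A)) \<in> I"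
  proof -
    have "A * C - ((p * \<alpha>) \<cdot> (b * X) - \<beta> \<cdot> (X * b) + (p * \<alpha> * \<gamma> * \<beta>) \<cdot> (C * A))
        = br (p * \<alpha>) A b * c - (\<beta> * \<beta> * \<gamma>) \<cdot> (c * br (p * \<alpha>) A b)"
      by (simp add: br_def C_def X_def scl_simps algebra_simps)
    then show ?thesis
      using ab by (simp add: qcomm_def A_def ideal_intros)
  qed
  have 2: "A * C - ((p * \<beta>) \<cdot> (Z * b) - \<alpha> \<cdot> (b * Z) + (p * \<alpha> * \<gamma> * \<beta>) \<cdot> (C * A)) \<in> I"
  proof -
    have "A * C - ((p * \<beta>) \<cdot> (Z * b) - \<alpha> \<cdot> (b * Z) + (p * \<alpha> * \<gamma> * \<beta>) \<cdot> (C * A))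
        = a * br (p * \<beta>) b C - (\<alpha> * \<alpha> * \<gamma>) \<cdot> (br (p * \<beta>) b C * a)"
      by (simp add: br_def A_def Z_def scl_simps algebra_simps)
    then show ?thesis
      using bc by (simp add: qcomm_def C_def ideal_intros)
  qed
  have "X * b - Z * b \<in> I" "b * X - b * Z \<in> I"
    using X' ideal_mult_right[of "X - Z" b] ideal_mult_left[of "X - Z" b]
    by (simp_all add: Z_def algebra_simps)
  note 3 = ideal_scl[OF this(1), of "p * \<beta>"] ideal_scl[OF this(2), of \<alpha>]
  have e: "\<alpha> * (\<delta> * p) = p"
    using al by (simp flip: mult.assoc)
  have "(1 + p) \<cdot> br (\<beta> * \<delta>) b X = \<delta> \<cdot> (
     - (A * C - ((p * \<alpha>) \<cdot> (b * X) - \<beta> \<cdot> (X * b) + (p * \<alpha> * \<gamma> * \<beta>) \<cdot> (C * A)))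
     + (A * C - ((p * \<beta>) \<cdot> (Z * b) - \<alpha> \<cdot> (b * Z) + (p * \<alpha> * \<gamma> * \<beta>) \<cdot> (C * A)))
     - (p * \<beta>) \<cdot> (X * b - Z * b) + \<alpha> \<cdot> (b * X - b * Z))"
    using al by (simp add: br_def[of "\<beta> * \<delta>"] scl_simps algebra_simps scl_one e)
  also have "\<dots> \<in> I"
    by (rule ideal_scl, rule ideal_add, rule ideal_diff, rule ideal_add, rule ideal_minus)
      (rule 1 2 3)+
  finally have "inverse (1 + p) \<cdot> ((1 + p) \<cdot> br (\<beta> * \<delta>) b X) \<in> I"
    by (rule ideal_scl)
  then show ?thesis
    using p by (simp add: scl_scl scl_one qcomm_def X_def A_def)
qed

section \<open>Powers of braided commutators\<close>

lemma qcomm_one_left: "qcomm 1 1 y"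
  by (simp add: qcomm_def br_def scl_one ideal_zero)

lemma qcomm_mult_left:
  assumes "qcomm c x z" "qcomm d y z"
  shows "qcomm (c * d) (x * y) z"
  \<comment> \<open>With coefficient 0 the bracket is the plain product.\<close>
  using qcomm_br_left[OF assms, of 0] by (simp add: br_def[of 0] scl_zero_left)

lemma qcomm_power_left: "qcomm c x y \<Longrightarrow> qcomm (c ^ m) (x ^ m) y"
  by (induction m) (auto intro: qcomm_mult_left qcomm_one_left)

text \<open>Plain expansions in which \<alpha> \<beta> p = 1 collapses the coefficients. The first
  two carry Serre relations from one order of the factors to the other; the third writes
  \<open>b * a\<close> through both commutators and starts the computation of powers.\<close>

lemma br_opposite:
  assumes "\<alpha> * \<beta> * p = 1"
  shows "br \<alpha> a (br \<beta> b a) = - (\<beta> \<cdot> br (p * \<alpha>) a (br \<alpha> a b))"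
    and "br (p * \<alpha>) (br \<alpha> a b) b = (p * \<alpha> * \<alpha>) \<cdot> br (p * \<beta>) b (br \<beta> b a)"
    and "br \<beta> b a + \<beta> \<cdot> br \<alpha> a b = (1 - \<alpha> * \<beta>) \<cdot> (b * a)"
proof -
  have "\<alpha> * (\<beta> * p) = (\<alpha> * \<beta> * p)" "\<alpha> * (\<alpha> * (\<beta> * p)) = (\<alpha> * \<beta> * p) * \<alpha>"
    "\<alpha> * (\<alpha> * (\<beta> * (p * p))) = (\<alpha> * \<beta> * p) * (\<alpha> * p)"
    "\<alpha> * (\<alpha> * (\<beta> * (\<beta> * (p * p)))) = (\<alpha> * \<beta> * p) * (\<alpha> * \<beta> * p)"
    by (simp_all only: mult_ac)
  note e = this[unfolded assms mult_1_left]
  show "br \<alpha> a (br \<beta> b a) = - (\<beta> \<cdot> br (p * \<alpha>) a (br \<alpha> a b))"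
    by (simp add: br_def scl_simps algebra_simps e scl_one)
  show "br (p * \<alpha>) (br \<alpha> a b) b = (p * \<alpha> * \<alpha>) \<cdot> br (p * \<beta>) b (br \<beta> b a)"
    by (simp add: br_def scl_simps algebra_simps e scl_one)
  show "br \<beta> b a + \<beta> \<cdot> br \<alpha> a b = (1 - \<alpha> * \<beta>) \<cdot> (b * a)"
    by (simp add: br_def scl_simps algebra_simps scl_one)
qed

lemma serre_opposite:
  assumes "qcomm (p * \<beta>) b (br \<beta> b a)" "\<alpha> * \<beta> * p = 1"
  shows "qcomm (p * \<alpha>) (br \<alpha> a b) b"
  using assms by (simp add: qcomm_def br_opposite(2)[OF assms(2)] ideal_intros)

text \<open>An ordered product, since the factors commute only modulo \<open>I\<close>.\<close>

primrec linear_prod :: "'r \<Rightarrow> 'r \<Rightarrow> (nat \<Rightarrow> 'k) \<Rightarrow> nat \<Rightarrow> 'r" where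
  "linear_prod W A t 0 = 1"
| "linear_prod W A t (Suc m) = linear_prod W A t m * (W + t m \<cdot> A)"

text \<open>As \<open>A\<close> commutes with \<open>W\<close> modulo \<open>I\<close>, the product
  expands like a polynomial in one variable, homogenised by powers of \<open>W\<close>.\<close>

lemma linear_prod_eqv:
  assumes WA: "qcomm 1 A W"
  shows "linear_prod W A t m \<approx> (\<Sum>l\<le>m. coeff (\<Prod>i<m. [:1, t i:]) l \<cdot> (W ^ (m - l) * A ^ l))"
proof (induction m)
  case 0
  then show ?case by (simp add: scl_one)
next
  case (Suc m)
  define P where "P = (\<Prod>i<m. [:1, t i:])"
  have deg: "degree P \<le> m"
    using degree_linear_prod_le[of t m] by (simp only: P_def)
  have P': "(\<Prod>i<Suc m. [:1, t i:]) = P + smult (t m) (pCons 0 P)"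
    by (simp add: P_def)
  have AW: "A ^ l * W \<approx> W * A ^ l" for l
    using qcomm_power_left[OF WA, of l] by (simp add: qcomm_iff scl_one)
  have "linear_prod W A t (Suc m) \<approx> (\<Sum>l\<le>m. coeff P l \<cdot> (W ^ (m - l) * A ^ l)) * (W + t m \<cdot> A)"
    using Suc by (auto simp: P_def intro: eqv_mult)
  also have "\<dots> = (\<Sum>l\<le>m. coeff P l \<cdot> (W ^ (m - l) * (A ^ l * W))
                        + (coeff P l * t m) \<cdot> (W ^ (m - l) * A ^ Suc l))"
    by (simp add: sum_distrib_right distrib_left scl_mult mult_scl scl_scl scl_add mult.assoc
        power_commutes mult.commute[of _ "t m"] scl_sum sum.distrib)
  also have "\<dots> \<approx> (\<Sum>l\<le>m. coeff P l \<cdot> (W ^ (m - l) * (W * A ^ l))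
                        + (coeff P l * t m) \<cdot> (W ^ (m - l) * A ^ Suc l))"
    by (intro eqv_sum eqv_add eqv_scl eqv_mult eqv_refl AW)
  also have "\<dots> = (\<Sum>l\<le>m. coeff P l \<cdot> (W ^ (Suc m - l) * A ^ l))
                  + (\<Sum>l\<le>m. (coeff P l * t m) \<cdot> (W ^ (Suc m - Suc l) * A ^ Suc l))"
    by (simp add: sum.distrib Suc_diff_le power_commutes flip: mult.assoc)
  \<comment> \<open>The added term l = m + 1 is zero because \<open>P\<close> has degree at most
    \<open>m\<close>.\<close>
  also have "(\<Sum>l\<le>m. coeff P l \<cdot> (W ^ (Suc m - l) * A ^ l))
      = (\<Sum>l\<le>Suc m. coeff P l \<cdot> (W ^ (Suc m - l) * A ^ l))"
    using deg by (simp add: coeff_eq_0 scl_zero_left)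
  also have "(\<Sum>l\<le>m. (coeff P l * t m) \<cdot> (W ^ (Suc m - Suc l) * A ^ Suc l))
      = (\<Sum>l\<le>Suc m. coeff (smult (t m) (pCons 0 P)) l \<cdot> (W ^ (Suc m - l) * A ^ l))"
    by (subst sum.atMost_Suc_shift) (simp add: scl_zero_left mult.commute)
  finally show ?case
    unfolding P' by (simp only: sum.distrib[symmetric] coeff_add add_scl)
qed

text \<open>
  Up to scalars \<open>b\<^sup>k a\<^sup>k\<close> is the product of the commuting elements \<open>W + \<beta> r\<^sup>l A\<close> for \<open>l < k\<close>, where
  \<open>r = p\<^sup>-\<^sup>1\<close>.  At \<open>k = m\<close> the \<open>r\<^sup>l\<close> run through all \<open>m\<close>-th roots of unity.
\<close>

lemma serre_power:
  assumes aA: "qcomm (p * \<alpha>) a (br \<alpha> a b)" and Ab: "qcomm (p * \<alpha>) (br \<alpha> a b) b"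
    and abp: "\<alpha> * \<beta> * p = 1"
    and p: "p ^ m = 1" "\<And>l. 0 < l \<Longrightarrow> l < m \<Longrightarrow> p ^ l \<noteq> 1" and m: "odd m"
  shows "((p - 1) ^ m * \<alpha> ^ (m * ((m - 1) div 2))) \<cdot> (b ^ m * a ^ m)
      \<approx> (br \<beta> b a) ^ m + \<beta> ^ m \<cdot> (br \<alpha> a b) ^ m"
proof -
  define A W r where "A = br \<alpha> a b" and "W = br \<beta> b a" and "r = \<alpha> * \<beta>"
  have rp: "r * p = 1"
    using abp by (simp add: r_def)
  have aW: "qcomm \<alpha> a W"
    using aA by (simp add: qcomm_def W_def br_opposite(1)[OF abp] ideal_intros)
  have C: "W + \<beta> \<cdot> A = (1 - r) \<cdot> (b * a)"
    unfolding W_def A_def r_def by (rule br_opposite(3)[OF abp])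
  \<comment> \<open>By \<open>C\<close>, \<open>W\<close> is a combination of \<open>b * a\<close>
    and \<open>A\<close>. The scalars from moving \<open>A\<close> past \<open>b\<close> and past
    \<open>a\<close> cancel: A b a = p \<alpha> b A a = b a A modulo \<open>I\<close>.\<close>
  have AW: "qcomm 1 A W"
  proof -
    have W: "W = (1 - r) \<cdot> (b * a) - \<beta> \<cdot> A"
      using C by (simp add: algebra_simps)
    have "br 1 A W = (1 - r) \<cdot> (br (p * \<alpha>) A b * a - b * br (p * \<alpha>) a A)"
      unfolding W by (simp add: br_def scl_simps algebra_simps scl_one)
    then show ?thesis
      using aA Ab by (simp add: qcomm_def A_def ideal_intros)
  qed
  \<comment> \<open>The power \<open>a ^ k\<close> passes \<open>W\<close> with the factor
    \<alpha>^k but \<open>A\<close> with (p \<alpha>)^k; the surplus p^k is compensated by r^k in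
    the coefficient of \<open>A\<close>.\<close>
  have shift: "\<alpha> ^ k \<cdot> ((W + \<beta> \<cdot> A) * a ^ k) \<approx> a ^ k * (W + (\<beta> * r ^ k) \<cdot> A)" for k
  proof -
    have 1: "a ^ k * W \<approx> \<alpha> ^ k \<cdot> (W * a ^ k)" "a ^ k * A \<approx> (p * \<alpha>) ^ k \<cdot> (A * a ^ k)"
      using qcomm_power_left[OF aW, of k] qcomm_power_left[OF aA, of k]
      by (simp_all add: qcomm_iff A_def)
    have e: "\<beta> * r ^ k * (p * \<alpha>) ^ k = \<alpha> ^ k * \<beta>"
      using arg_cong[OF rp, of "\<lambda>x. x ^ k"] by (simp add: power_mult_distrib algebra_simps)
    have "a ^ k * (W + (\<beta> * r ^ k) \<cdot> A) = a ^ k * W + (\<beta> * r ^ k) \<cdot> (a ^ k * A)"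
      by (simp add: distrib_left mult_scl)
    also have "\<dots> \<approx> \<alpha> ^ k \<cdot> (W * a ^ k) + (\<beta> * r ^ k) \<cdot> ((p * \<alpha>) ^ k \<cdot> (A * a ^ k))"
      by (intro eqv_add eqv_scl 1)
    also have "\<dots> = \<alpha> ^ k \<cdot> ((W + \<beta> \<cdot> A) * a ^ k)"
      by (simp only: scl_scl e) (simp add: distrib_right scl_add scl_mult scl_scl)
    finally show ?thesis
      by (rule eqv_sym)
  qed
  \<comment> \<open>The product \<open>b ^ Suc k * a ^ Suc k\<close> has \<open>b * a\<close> in its
    middle. By \<open>C\<close> this is a linear factor up to 1 - r, and \<open>shift\<close>
    carries it to the right end at the cost of \<alpha>^k; these costs accumulate in the
    exponent.\<close>
  have prod: "((1 - r) ^ k * \<alpha> ^ (\<Sum>l<k. l)) \<cdot> (b ^ k * a ^ k) \<approx> linear_prod W A (\<lambda>l. \<beta> * r ^ l) k" for k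
  proof (induction k)
    case 0
    then show ?case by (simp add: scl_one)
  next
    case (Suc k)
    have "((1 - r) ^ Suc k * \<alpha> ^ (\<Sum>l<Suc k. l)) \<cdot> (b ^ Suc k * a ^ Suc k)
        = ((1 - r) ^ k * \<alpha> ^ (\<Sum>l<k. l)) \<cdot> (b ^ k * (\<alpha> ^ k \<cdot> ((1 - r) \<cdot> (b * a) * a ^ k)))"
      by (simp only: power_Suc2[of b] power_Suc[of a] mult.assoc scl_mult mult_scl scl_scl)
        (simp add: power_add mult_ac)
    also have "\<dots> = ((1 - r) ^ k * \<alpha> ^ (\<Sum>l<k. l)) \<cdot> (b ^ k * (\<alpha> ^ k \<cdot> ((W + \<beta> \<cdot> A) * a ^ k)))"
      by (simp only: C)
    also have "\<dots> \<approx> ((1 - r) ^ k * \<alpha> ^ (\<Sum>l<k. l)) \<cdot> (b ^ k * (a ^ k * (W + (\<beta> * r ^ k) \<cdot> A)))"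
      by (intro eqv_scl eqv_mult eqv_refl shift)
    also have "\<dots> = (((1 - r) ^ k * \<alpha> ^ (\<Sum>l<k. l)) \<cdot> (b ^ k * a ^ k)) * (W + (\<beta> * r ^ k) \<cdot> A)"
      by (simp add: scl_mult mult.assoc)
    also have "\<dots> \<approx> linear_prod W A (\<lambda>l. \<beta> * r ^ l) k * (W + (\<beta> * r ^ k) \<cdot> A)"
      by (intro eqv_mult Suc eqv_refl)
    finally show ?case
      by simp
  qed
  \<comment> \<open>For odd \<open>m\<close> the halving is exact, so the exponent of \<alpha> is a
    multiple of \<open>m\<close>. This is what later allows (R2) to remove that power.\<close>
  have gauss: "(\<Sum>l<m. l) = m * ((m - 1) div 2)"
  proof -
    obtain k where k: "m = Suc (2 * k)"
      using m by (auto elim: oddE)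
    have "(\<Sum>l<Suc (2 * k). l) = Suc (2 * k) * k"
      by (induction k) auto
    then show ?thesis
      by (simp add: k)
  qed
  \<comment> \<open>Both polynomials have degree at most \<open>m\<close> and agree at m + 1 points:
    at 0, and at - p^l / \<beta> for l < m, which are distinct since \<open>p\<close> has order
    \<open>m\<close>. At the latter both vanish, the right side because \<open>m\<close> is odd. The
    local \<open>A\<close> is this set of points.\<close>
  have P: "(\<Prod>l<m. [:1, \<beta> * r ^ l:]) = 1 + monom (\<beta> ^ m) m"
  proof (rule poly_eqI_degree)
    have "\<beta> \<noteq> 0" "p \<noteq> 0"
      using abp by auto
    define A where "A = insert 0 ((\<lambda>l. - (p ^ l / \<beta>)) ` {..<m})"
    have inj: "inj_on (\<lambda>l. - (p ^ l / \<beta>)) {..<m}"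
    proof (rule linorder_inj_onI')
      fix k l assume kl: "k \<in> {..<m}" "l \<in> {..<m}" "k < l"
      have "p ^ l = p ^ k * p ^ (l - k)"
        using kl by (simp flip: power_add)
      then show "- (p ^ k / \<beta>) \<noteq> - (p ^ l / \<beta>)"
        using kl p(2)[of "l - k"] \<open>\<beta> \<noteq> 0\<close> \<open>p \<noteq> 0\<close> by simp
    qed
    have card: "card A = Suc m"
    proof -
      have "0 \<notin> (\<lambda>l. - (p ^ l / \<beta>)) ` {..<m}"
        using \<open>\<beta> \<noteq> 0\<close> \<open>p \<noteq> 0\<close> by auto
      then show ?thesis
        by (simp add: A_def card_image[OF inj])
    qed
    show "degree (\<Prod>l<m. [:1, \<beta> * r ^ l:]) < card A"
      using degree_linear_prod_le[of "\<lambda>l. \<beta> * r ^ l" m] unfolding card by (rule le_imp_less_Suc)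
    show "degree (1 + monom (\<beta> ^ m) m) < card A"
      unfolding card using degree_monom_le[of "\<beta> ^ m" m]
      by (intro le_imp_less_Suc degree_add_le) auto
    fix x assume "x \<in> A"
    then consider "x = 0" | l where "l < m" "x = - (p ^ l / \<beta>)"
      by (auto simp: A_def)
    then show "poly (\<Prod>l<m. [:1, \<beta> * r ^ l:]) x = poly (1 + monom (\<beta> ^ m) m) x"
    proof cases
      case 1
      then show ?thesis
        using m by (auto simp: poly_prod poly_monom elim: oddE)
    next
      case 2
      have "r ^ l * p ^ l = 1"
        using rp by (metis power_mult_distrib power_one)
      then have "poly [:1, \<beta> * r ^ l:] x = 0"
        using 2 \<open>\<beta> \<noteq> 0\<close> by (simp add: mult.commute)
      then have "poly (\<Prod>l<m. [:1, \<beta> * r ^ l:]) x = 0"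
        using 2 by (auto simp: poly_prod intro!: prod_zero)
      moreover have "(p ^ l) ^ m = 1"
        by (metis p(1) power_mult power_one mult.commute)
      then have "\<beta> ^ m * x ^ m = - 1"
        using 2 m \<open>\<beta> \<noteq> 0\<close> by (simp add: power_divide)
      ultimately show ?thesis
        by (simp add: poly_monom)
    qed
  qed
  have m0: "m \<noteq> 0"
    using m by (auto elim: oddE)
  have pm: "(1 - r) ^ m = (p - 1) ^ m"
  proof -
    have "p * (1 - r) = p - 1"
      using rp by (simp add: algebra_simps)
    then have "p ^ m * (1 - r) ^ m = (p - 1) ^ m"
      by (metis power_mult_distrib)
    then show ?thesis
      by (simp add: p)
  qed
  have "((p - 1) ^ m * \<alpha> ^ (m * ((m - 1) div 2))) \<cdot> (b ^ m * a ^ m) \<approx> linear_prod W A (\<lambda>l. \<beta> * r ^ l) m"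
    using prod[of m] by (simp add: gauss pm)
  also have "\<dots> \<approx> (\<Sum>l\<le>m. coeff (1 + monom (\<beta> ^ m) m) l \<cdot> (W ^ (m - l) * A ^ l))"
    using linear_prod_eqv[OF AW, of "\<lambda>l. \<beta> * r ^ l" m] unfolding P .
  also have "\<dots> = (\<Sum>l\<in>{0, m}. coeff (1 + monom (\<beta> ^ m) m) l \<cdot> (W ^ (m - l) * A ^ l))"
    by (intro sum.mono_neutral_right) (auto simp: scl_zero_left)
  also have "\<dots> = W ^ m + \<beta> ^ m \<cdot> A ^ m"
    using m0 by (simp add: scl_one)
  finally show ?thesis
    by (simp add: W_def A_def)
qed

end

section \<open>Root vectors of type \<open>A\<^sub>n\<close>\<close>

text \<open>Only the braiding and the quantum Serre relations are assumed, so that the locale can be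
  instantiated a second time with the numbering of the generators reversed.\<close>

locale type_A_algebra = algebra_ideal scl I
  for scl :: "'k::field \<Rightarrow> 'r::ring_1 \<Rightarrow> 'r" (infixr "\<cdot>" 75) and I +
  fixes n :: nat and x :: "nat \<Rightarrow> 'r" and q :: "nat \<Rightarrow> nat \<Rightarrow> 'k" and p :: 'k
  assumes q_diag: "i \<in> {1..n} \<Longrightarrow> q i i = p"
    and q_adj: "i \<in> {1..n} \<Longrightarrow> j \<in> {1..n} \<Longrightarrow> i = Suc j \<or> j = Suc i \<Longrightarrow> q i j * q j i * p = 1"
    and q_far: "i \<in> {1..n} \<Longrightarrow> j \<in> {1..n} \<Longrightarrow> Suc i < j \<or> Suc j < i \<Longrightarrow> q i j * q j i = 1"
    and one_plus_p: "1 + p \<noteq> 0"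
    and x_far: "i \<in> {1..n} \<Longrightarrow> j \<in> {1..n} \<Longrightarrow> Suc i < j \<or> Suc j < i \<Longrightarrow> qcomm (q i j) (x i) (x j)"
    and x_adj: "i \<in> {1..n} \<Longrightarrow> j \<in> {1..n} \<Longrightarrow> i = Suc j \<or> j = Suc i \<Longrightarrow>
      qcomm (p * q i j) (x i) (br (q i j) (x i) (x j))"
begin

section \<open>The bicharacter chi_kl(g_ij) on pairs of roots\<close>

definition bichar :: "nat \<Rightarrow> nat \<Rightarrow> nat \<Rightarrow> nat \<Rightarrow> 'k" where
  "bichar i j k l = (\<Prod>s\<in>{i..<j}. \<Prod>t\<in>{k..<l}. q s t)"

lemma bichar_single [simp]: "bichar i (Suc i) k (Suc k) = q i k"
  by (simp add: bichar_def)

lemma bichar_empty [simp]: "bichar i i k l = 1" "bichar i j k k = 1"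
  by (simp_all add: bichar_def)

lemma bichar_split_left: "i \<le> m \<Longrightarrow> m \<le> j \<Longrightarrow> bichar i j k l = bichar i m k l * bichar m j k l"
  by (simp add: bichar_def prod.atLeastLessThan_concat)

lemma bichar_split_right: "k \<le> m \<Longrightarrow> m \<le> l \<Longrightarrow> bichar i j k l = bichar i j k m * bichar i j m l"
  by (simp add: bichar_def prod.atLeastLessThan_concat flip: prod.distrib)

lemma bichar_sym: "bichar i j k l * bichar k l i j = (\<Prod>s\<in>{i..<j}. \<Prod>t\<in>{k..<l}. q s t * q t s)"
  unfolding bichar_def by (subst (2) prod.swap) (simp flip: prod.distrib)

lemma bichar_far:
  assumes "1 \<le> i" "j < k" "l \<le> Suc n"
  shows "bichar i j k l * bichar k l i j = 1"
  unfolding bichar_sym using assms by (intro prod.neutral ballI) (auto intro: q_far)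

text \<open>Among the pairs of simple roots on the two sides of \<open>j\<close>, only j - 1 and j
  are adjacent and contribute p^-1; all other pairs cancel.\<close>

lemma bichar_adj:
  assumes "1 \<le> i" "i < j" "j < k" "k \<le> Suc n"
  shows "bichar i j j k * bichar j k i j * p = 1"
proof -
  obtain m where m: "j = Suc m"
    using assms by (cases j) auto
  have 1: "bichar i j j k = bichar i m j k * (q m j * bichar m j (Suc j) k)"
    using assms bichar_split_left[of i m j j k] bichar_split_right[of j "Suc j" k m j]
    by (simp add: m)
  have 2: "bichar j k i j = bichar j k i m * (q j m * bichar (Suc j) k m j)"
    using assms bichar_split_right[of i m j j k] bichar_split_left[of j "Suc j" k m j]
    by (simp add: m)
  have "bichar i j j k * bichar j k i j * p = (bichar i m j k * bichar j k i m)
      * (bichar m j (Suc j) k * bichar (Suc j) k m j) * (q m j * q j m * p)"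
    unfolding 1 2 by (simp only: mult_ac)
  also have "\<dots> = 1"
  proof -
    have "bichar m j (Suc j) k * bichar (Suc j) k m j = 1"
      using assms by (intro bichar_far) (auto simp: m)
    moreover have "bichar i m j k * bichar j k i m = 1"
      using assms by (intro bichar_far) (auto simp: m)
    moreover have "q m j * q j m * p = 1"
      using assms by (intro q_adj) (auto simp: m)
    ultimately show ?thesis
      by simp
  qed
  finally show ?thesis .
qed

text \<open>Appending a simple root contributes \<open>p\<close> from the diagonal and p^-1 from its
  adjacency to the previous roots.\<close>

lemma bichar_self:
  assumes "1 \<le> i" "i < j" "j \<le> Suc n"
  shows "bichar i j i j = p"
  using Suc_leI[OF assms(2)] assms(3)
proof (induction j rule: nat_induct_at_least)
  case base
  then show ?case using assms(1) by (simp add: q_diag)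
next
  case (Suc j)
  have "bichar i (Suc j) i (Suc j) = bichar i j i j * q j j * (bichar i j j (Suc j) * bichar j (Suc j) i j)"
    using Suc bichar_split_left[of i j "Suc j" i "Suc j"] bichar_split_right[of i j "Suc j" i j]
      bichar_split_right[of i j "Suc j" j "Suc j"]
    by simp
  also have "\<dots> = p * (bichar i j j (Suc j) * bichar j (Suc j) i j * p)"
    using Suc by (simp add: q_diag)
  also have "\<dots> = p"
    using Suc assms(1) by (subst bichar_adj) auto
  finally show ?case .
qed

section \<open>Root vectors and their q-commutation\<close>

function root :: "nat \<Rightarrow> nat \<Rightarrow> 'r" where
  "root i j = (if j \<le> Suc i then x i
     else br (bichar i (Suc i) (Suc i) j) (x i) (root (Suc i) j))"
  by auto
termination
  by (relation "measure (\<lambda>(i, j). j - i)") auto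

function rroot :: "nat \<Rightarrow> nat \<Rightarrow> 'r" where
  "rroot j i = (if j \<le> Suc i then x i
     else br (bichar (j - 1) j i (j - 1)) (x (j - 1)) (rroot (j - 1) i))"
  by auto
termination
  by (relation "measure (\<lambda>(j, i). j - i)") auto

declare root.simps [simp del] rroot.simps [simp del]

lemma root_simple [simp]: "root i (Suc i) = x i"
  by (simp add: root.simps)

lemma root_step: "Suc i < j \<Longrightarrow> root i j = br (bichar i (Suc i) (Suc i) j) (x i) (root (Suc i) j)"
  by (subst root.simps) simp

lemma rroot_simple [simp]: "rroot (Suc i) i = x i"
  by (simp add: rroot.simps)

lemma rroot_step: "i < j \<Longrightarrow> rroot (Suc j) i = br (bichar j (Suc j) i j) (x j) (rroot j i)"
  by (subst rroot.simps) simp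

text \<open>Scalars multiply along iterated brackets, so q-commutation with a root vector is
  inherited from its letters.\<close>

lemma qcomm_root_left:
  assumes "i < j" "\<And>k. k \<in> {i..<j} \<Longrightarrow> qcomm (bichar k (Suc k) l m) (x k) y"
  shows "qcomm (bichar i j l m) (root i j) y"
  using assms
proof (induction i j rule: root.induct)
  case (1 i j)
  show ?case
  proof (cases "j = Suc i")
    case False
    then have "qcomm (bichar (Suc i) j l m) (root (Suc i) j) y"
      using 1 by auto
    moreover have "qcomm (bichar i (Suc i) l m) (x i) y"
      using 1 by auto
    ultimately show ?thesis
      using 1 False by (simp add: root_step bichar_split_left[of i "Suc i" j] qcomm_br_left)
  qed (use 1 in auto)
qed

lemma qcomm_root_right:
  assumes "i < j" "\<And>k. k \<in> {i..<j} \<Longrightarrow> qcomm (bichar l m k (Suc k)) y (x k)"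
  shows "qcomm (bichar l m i j) y (root i j)"
  using assms
proof (induction i j rule: root.induct)
  case (1 i j)
  show ?case
  proof (cases "j = Suc i")
    case False
    then have "qcomm (bichar l m (Suc i) j) y (root (Suc i) j)"
      using 1 by auto
    moreover have "qcomm (bichar l m i (Suc i)) y (x i)"
      using 1 by auto
    ultimately show ?thesis
      using 1 False by (simp add: root_step bichar_split_right[of i "Suc i" j] qcomm_br_right)
  qed (use 1 in auto)
qed

lemma qcomm_rroot_right:
  assumes "i < j" "\<And>k. k \<in> {i..<j} \<Longrightarrow> qcomm (bichar l m k (Suc k)) y (x k)"
  shows "qcomm (bichar l m i j) y (rroot j i)"
  using Suc_leI[OF assms(1)] assms(2)
proof (induction j rule: nat_induct_at_least)
  case (Suc j)
  then have "qcomm (bichar l m i j) y (rroot j i)" "qcomm (bichar l m j (Suc j)) y (x j)"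
    by auto
  then show ?case
    using Suc by (simp add: rroot_step bichar_split_right[of i j "Suc j"] qcomm_br_right mult.commute[of "bichar l m i j"])
qed simp

lemma x_far': "i \<in> {1..n} \<Longrightarrow> j \<in> {1..n} \<Longrightarrow> Suc i < j \<or> Suc j < i \<Longrightarrow>
    qcomm (bichar i (Suc i) j (Suc j)) (x i) (x j)"
  by (simp add: x_far)

lemma x_root_far:
  assumes "1 \<le> i" "i < j" "j \<le> Suc n" "k \<in> {1..n}" "Suc k < i \<or> j < k"
  shows "qcomm (bichar k (Suc k) i j) (x k) (root i j)" "qcomm (bichar i j k (Suc k)) (root i j) (x k)"
  using assms by (intro qcomm_root_right qcomm_root_left x_far'; auto)+

lemma root_rroot_far:
  assumes "1 \<le> i" "i < j" "j < k" "k < l" "l \<le> Suc n"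
  shows "qcomm (bichar i j k l) (root i j) (rroot l k)"
  using assms by (intro qcomm_root_left qcomm_rroot_right x_far') auto

text \<open>The first letter is peeled off and returned by the Jacobi identity, which applies
  because x_i and x_mj have separated supports once m > i + 1.\<close>

lemma root_split:
  assumes "1 \<le> i" "i < m" "m < j" "j \<le> Suc n"
  shows "root i j \<approx> br (bichar i m m j) (root i m) (root m j)"
  using assms
proof (induction i m rule: root.induct)
  case (1 i m)
  show ?case
  proof (cases "m = Suc i")
    case False
    have "root i j \<approx> br (bichar i (Suc i) (Suc i) j) (x i) (br (bichar (Suc i) m m j) (root (Suc i) m) (root m j))"
      using 1 False by (simp add: root_step eqv_br)
    also have "bichar i (Suc i) (Suc i) j = bichar i (Suc i) (Suc i) m * bichar i (Suc i) m j"
      using 1 by (intro bichar_split_right) auto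
    also have "br \<dots> (x i) (br (bichar (Suc i) m m j) (root (Suc i) m) (root m j)) \<approx>
        br (bichar (Suc i) m m j * bichar i (Suc i) m j) (br (bichar i (Suc i) (Suc i) m) (x i) (root (Suc i) m)) (root m j)"
      using 1 False by (intro br_jacobi x_root_far) auto
    also have "br (bichar i (Suc i) (Suc i) m) (x i) (root (Suc i) m) = root i m"
      using 1 False by (simp add: root_step)
    also have "bichar (Suc i) m m j * bichar i (Suc i) m j = bichar i m m j"
      using 1 by (simp add: bichar_split_left[of i "Suc i" m])
    finally show ?thesis .
  qed (use 1(2-) in \<open>simp add: root_step\<close>)
qed

text \<open>The Serre relation is the case j = i + 2. Beyond it, x_ij is a bracket of x_(i,i+2) with
  a root vector far from x_i.\<close>

lemma x_root_first:
  assumes "1 \<le> i" "Suc i < j" "j \<le> Suc n"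
  shows "qcomm (bichar i (Suc i) i j) (x i) (root i j)"
proof -
  have base: "qcomm (bichar i (Suc i) i (Suc (Suc i))) (x i) (root i (Suc (Suc i)))"
    using x_adj[of i "Suc i"] assms
    by (simp add: root_step bichar_split_right[of i "Suc i" "Suc (Suc i)"] q_diag)
  show ?thesis
  proof (cases "j = Suc (Suc i)")
    case False
    then have "root i j \<approx> br (bichar i (Suc (Suc i)) (Suc (Suc i)) j) (root i (Suc (Suc i))) (root (Suc (Suc i)) j)"
      using assms by (intro root_split) auto
    moreover have "qcomm (bichar i (Suc i) (Suc (Suc i)) j) (x i) (root (Suc (Suc i)) j)"
      using False assms by (intro x_root_far) auto
    from qcomm_br_right[OF base this]
    have "qcomm (bichar i (Suc i) i j) (x i) (br (bichar i (Suc (Suc i)) (Suc (Suc i)) j) (root i (Suc (Suc i))) (root (Suc (Suc i)) j))"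
      using assms by (simp flip: bichar_split_right)
    ultimately show ?thesis
      using qcomm_cong by blast
  qed (use base in simp)
qed

text \<open>Mirror image of the first-letter case; \<open>serre_opposite\<close> is needed because
  the Serre relations are given with the repeated letter on the left.\<close>

lemma root_x_last:
  assumes "1 \<le> i" "i < j" "j \<le> n"
  shows "qcomm (bichar i (Suc j) j (Suc j)) (root i (Suc j)) (x j)"
proof -
  obtain m where m: "j = Suc m"
    using assms by (cases j) auto
  have base: "qcomm (bichar m (Suc j) j (Suc j)) (root m (Suc j)) (x j)"
  proof -
    have "qcomm (p * q m j) (br (q m j) (x m) (x j)) (x j)"
    proof (rule serre_opposite)
      show "qcomm (p * q j m) (x j) (br (q j m) (x j) (x m))"
        using assms by (intro x_adj) (auto simp: m)
      show "q m j * q j m * p = 1"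
        using assms by (intro q_adj) (auto simp: m)
    qed
    then show ?thesis
      using assms bichar_split_left[of m j "Suc j" j "Suc j"]
      by (simp add: root_step q_diag m mult.commute)
  qed
  show ?thesis
  proof (cases "m = i")
    case False
    then have "root i (Suc j) \<approx> br (bichar i m m (Suc j)) (root i m) (root m (Suc j))"
      using assms by (intro root_split) (auto simp: m)
    moreover have "qcomm (bichar i m j (Suc j)) (root i m) (x j)"
      using False assms by (intro x_root_far) (auto simp: m)
    from qcomm_br_left[OF this base]
    have "qcomm (bichar i (Suc j) j (Suc j)) (br (bichar i m m (Suc j)) (root i m) (root m (Suc j))) (x j)"
      using assms False m bichar_split_left[of i m "Suc j" j "Suc j"] by simp
    ultimately show ?thesis
      using qcomm_cong by blast
  qed (use base in simp)
qed

text \<open>An interior letter is handled by \<open>qcomm_middle\<close> with a = x_ik, b = x_k and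
  c = x_(k+1,j); its hypotheses are the last-letter and first-letter cases.\<close>

lemma x_root_middle:
  assumes "1 \<le> i" "i < k" "Suc k < j" "j \<le> Suc n"
  shows "qcomm (bichar k (Suc k) i j) (x k) (root i j)"
proof -
  let ?\<alpha> = "bichar i k k (Suc k)" and ?\<beta> = "bichar k (Suc k) (Suc k) j" and ?\<gamma> = "bichar i k (Suc k) j"
    and ?\<delta> = "bichar k (Suc k) i k * p"
  have ac: "qcomm ?\<gamma> (root i k) (root (Suc k) j)"
    using assms by (intro qcomm_root_left qcomm_root_right x_far') auto
  have a: "root i (Suc k) \<approx> br ?\<alpha> (root i k) (x k)"
    using root_split[of i k "Suc k"] assms by simp
  have ab: "qcomm (p * ?\<alpha>) (br ?\<alpha> (root i k) (x k)) (x k)"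
    using root_x_last[of i k] assms qcomm_cong[OF a eqv_refl]
      bichar_split_left[of i k "Suc k" k "Suc k"] by (simp add: q_diag mult.commute)
  have bc: "qcomm (p * ?\<beta>) (x k) (br ?\<beta> (x k) (root (Suc k) j))"
    using x_root_first[of k j] assms bichar_split_right[of k "Suc k" j k "Suc k"]
    by (simp add: q_diag root_step)
  have "?\<alpha> * ?\<delta> = 1"
    using bichar_adj[of i k "Suc k"] assms by (simp add: mult_ac)
  from qcomm_middle[OF ac ab bc one_plus_p this]
  have "qcomm (?\<beta> * ?\<delta>) (x k) (br (?\<beta> * ?\<gamma>) (br ?\<alpha> (root i k) (x k)) (root (Suc k) j))" .
  moreover have "?\<beta> * ?\<delta> = bichar k (Suc k) i j"
    using assms bichar_split_right[of i k j k "Suc k"] bichar_split_right[of k "Suc k" j k "Suc k"]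
    by (simp add: q_diag mult_ac)
  moreover have "root i j \<approx> br (?\<beta> * ?\<gamma>) (br ?\<alpha> (root i k) (x k)) (root (Suc k) j)"
  proof -
    have "root i j \<approx> br (bichar i (Suc k) (Suc k) j) (root i (Suc k)) (root (Suc k) j)"
      using assms by (intro root_split) auto
    also have "\<dots> \<approx> br (bichar i (Suc k) (Suc k) j) (br ?\<alpha> (root i k) (x k)) (root (Suc k) j)"
      by (intro eqv_br a eqv_refl)
    finally show ?thesis
      using assms by (simp add: bichar_split_left[of i k "Suc k"] mult.commute)
  qed
  ultimately show ?thesis
    using qcomm_cong by (metis eqv_refl)
qed

text \<open>Every letter of x_im is the first or an interior letter of x_(i,m+1), never its last
  one.\<close>

lemma root_root_Suc:
  assumes "1 \<le> i" "i < m" "m \<le> n"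
  shows "qcomm (bichar i m i (Suc m)) (root i m) (root i (Suc m))"
proof (rule qcomm_root_left)
  fix k assume "k \<in> {i..<m}"
  then show "qcomm (bichar k (Suc k) i (Suc m)) (x k) (root i (Suc m))"
    using assms by (cases "k = i") (auto intro: x_root_first x_root_middle)
qed (use assms in auto)

section \<open>The flip of the Dynkin diagram\<close>

lemma reversed_algebra:
  "type_A_algebra scl I n (\<lambda>i. x (Suc n - i)) (\<lambda>i j. q (Suc n - i) (Suc n - j)) p"
proof (unfold_locales, goal_cases)
  case (1 i) then show ?case by (intro q_diag) auto
next
  case (2 i j) then show ?case by (intro q_adj) auto
next
  case (3 i j) then show ?case by (intro q_far) auto
next
  case 4 then show ?case by (rule one_plus_p)
next
  case (5 i j) then show ?case by (intro x_far) auto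
next
  case (6 i j) then show ?case by (intro x_adj) auto
qed

lemma prod_reverse:
  fixes f :: "nat \<Rightarrow> 'k"
  assumes "j \<le> Suc (Suc n)"
  shows "(\<Prod>s\<in>{i..<j}. f (Suc n - s)) = (\<Prod>s\<in>{Suc (Suc n) - j..<Suc (Suc n) - i}. f s)"
  using assms
  by (intro prod.reindex_bij_witness[of _ "\<lambda>s. Suc n - s" "\<lambda>s. Suc n - s"]) auto

lemma bichar_reversed:
  assumes "j \<le> Suc (Suc n)" "l \<le> Suc (Suc n)"
  shows "type_A_algebra.bichar (\<lambda>i j. q (Suc n - i) (Suc n - j)) i j k l
    = bichar (Suc (Suc n) - j) (Suc (Suc n) - i) (Suc (Suc n) - l) (Suc (Suc n) - k)"
proof -
  interpret rev: type_A_algebra scl I n "\<lambda>i. x (Suc n - i)" "\<lambda>i j. q (Suc n - i) (Suc n - j)" p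
    by (rule reversed_algebra)
  show ?thesis
    unfolding rev.bichar_def bichar_def
    by (simp add: prod_reverse[OF assms(1), of "\<lambda>s. \<Prod>t\<in>{Suc (Suc n) - l..<Suc (Suc n) - k}. q s t"]
        prod_reverse[OF assms(2)])
qed

text \<open>The flip exchanges root vectors and reverse root vectors, so each result on
  \<open>root\<close> yields one on \<open>rroot\<close>.\<close>

lemma root_reversed:
  assumes "1 \<le> i" "i < j" "j \<le> Suc n"
  shows "type_A_algebra.root scl (\<lambda>i. x (Suc n - i)) (\<lambda>i j. q (Suc n - i) (Suc n - j)) i j
    = rroot (Suc (Suc n) - i) (Suc (Suc n) - j)"
proof -
  interpret rev: type_A_algebra scl I n "\<lambda>i. x (Suc n - i)" "\<lambda>i j. q (Suc n - i) (Suc n - j)" p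
    by (rule reversed_algebra)
  show ?thesis
    using assms
  proof (induction i j rule: rev.root.induct)
    case (1 i j)
    show ?case
    proof (cases "j = Suc i")
      case True
      then show ?thesis
        using 1 rroot_simple[of "Suc n - i"] by (simp add: Suc_diff_le)
    next
      case False
      have e: "Suc (Suc n) - i = Suc (Suc n - i)"
        using 1 by simp
      have "rev.root (Suc i) j = rroot (Suc n - i) (Suc (Suc n) - j)"
        using 1 False by simp
      then show ?thesis
        using 1 False unfolding e
        by (simp add: rev.root_step rroot_step bichar_reversed e)
    qed
  qed
qed

lemma rroot_split:
  assumes "1 \<le> i" "i < m" "m < j" "j \<le> Suc n"
  shows "rroot j i \<approx> br (bichar m j i m) (rroot j m) (rroot m i)"
proof -
  interpret rev: type_A_algebra scl I n "\<lambda>i. x (Suc n - i)" "\<lambda>i j. q (Suc n - i) (Suc n - j)" p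
    by (rule reversed_algebra)
  show ?thesis
    using rev.root_split[of "Suc (Suc n) - j" "Suc (Suc n) - m" "Suc (Suc n) - i"] assms
    by (simp add: root_reversed bichar_reversed)
qed

lemma rroot_rroot_Suc:
  assumes "1 \<le> i" "Suc i < j" "j \<le> Suc n"
  shows "qcomm (bichar (Suc i) j i j) (rroot j (Suc i)) (rroot j i)"
proof -
  interpret rev: type_A_algebra scl I n "\<lambda>i. x (Suc n - i)" "\<lambda>i j. q (Suc n - i) (Suc n - j)" p
    by (rule reversed_algebra)
  show ?thesis
    using rev.root_root_Suc[of "Suc (Suc n) - j" "Suc n - i"] assms
    by (simp add: root_reversed bichar_reversed Suc_diff_le)
qed

text \<open>
  The elements \<open>mixed i m j\<close> interpolate between \<open>x\<^sub>j\<^sub>i\<close>, at \<open>m = i + 1\<close>, and \<open>x\<^sub>i\<^sub>j\<close>, at \<open>m = j\<close>.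
\<close>

definition mixed :: "nat \<Rightarrow> nat \<Rightarrow> nat \<Rightarrow> 'r" where
  "mixed i m j = (if m = j then root i j else br (bichar m j i m) (rroot j m) (root i m))"

text \<open>Write x_jm as the bracket of x_(j,m+1) and x_m, bring x_(j,m+1) to the outside by
  \<open>br_exchange\<close>, and absorb x_m into x_im by \<open>root_split\<close>.\<close>

lemma mixed_Suc:
  assumes "1 \<le> i" "i < m" "m < j" "j \<le> Suc n"
  shows "br (bichar i m m j) (root i m) (rroot j m) \<approx> bichar i m (Suc m) j \<cdot> mixed i (Suc m) j"
proof (cases "j = Suc m")
  case True
  then show ?thesis
    using root_split[of i m j] assms eqv_sym by (simp add: mixed_def scl_one)
next
  case False
  have "br (bichar i m m j) (root i m) (rroot j m)
      \<approx> br (bichar i m m j) (root i m) (br (bichar (Suc m) j m (Suc m)) (rroot j (Suc m)) (x m))"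
    using rroot_split[of m "Suc m" j] assms False by (intro eqv_br) auto
  also have e: "bichar i m m j = bichar i m (Suc m) j * bichar i m m (Suc m)"
    using assms by (simp add: bichar_split_right[of m "Suc m" j])
  also have "br \<dots> (root i m) (br (bichar (Suc m) j m (Suc m)) (rroot j (Suc m)) (x m))
      \<approx> bichar i m (Suc m) j \<cdot> br (bichar (Suc m) j m (Suc m) * bichar (Suc m) j i m)
          (rroot j (Suc m)) (br (bichar i m m (Suc m)) (root i m) (x m))"
    using assms False by (intro br_exchange root_rroot_far bichar_far) auto
  also have "\<dots> \<approx> bichar i m (Suc m) j \<cdot> br (bichar (Suc m) j i (Suc m)) (rroot j (Suc m)) (root i (Suc m))"
  proof -
    have "bichar (Suc m) j m (Suc m) * bichar (Suc m) j i m = bichar (Suc m) j i (Suc m)"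
      using assms by (simp add: bichar_split_right[of i m "Suc m"] mult.commute)
    moreover have "br (bichar i m m (Suc m)) (root i m) (x m) \<approx> root i (Suc m)"
      using root_split[of i m "Suc m"] assms by (simp add: eqv_sym)
    ultimately show ?thesis
      by (auto intro: eqv_scl eqv_br)
  qed
  finally show ?thesis
    using False by (simp add: mixed_def e)
qed

lemma mixed_first:
  assumes "1 \<le> i" "i < j" "j \<le> Suc n"
  shows "rroot j i \<approx> mixed i (Suc i) j"
  using rroot_split[of i "Suc i" j] assms by (cases "j = Suc i") (auto simp: mixed_def)

text \<open>By \<open>mixed_Suc\<close> the inner bracket is a multiple of
  \<open>mixed i (Suc m) j\<close>, which is built from x_(i,m+1) and x_(j,m+1); x_im q-commutes
  with both.\<close>

lemma pair_serre_left:
  assumes "1 \<le> i" "i < m" "m < j" "j \<le> Suc n"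
  shows "qcomm (p * bichar i m m j) (root i m) (br (bichar i m m j) (root i m) (rroot j m))"
proof -
  have 1: "qcomm (bichar i m i (Suc m)) (root i m) (root i (Suc m))"
    using assms by (intro root_root_Suc) auto
  have e: "bichar i m i (Suc m) = p * bichar i m m (Suc m)"
    using assms bichar_split_right[of i m "Suc m" i m] by (simp add: bichar_self)
  have "qcomm (p * bichar i m m j) (root i m) (mixed i (Suc m) j)"
  proof (cases "j = Suc m")
    case True
    then show ?thesis
      using 1 e by (simp add: mixed_def)
  next
    case False
    have "qcomm (bichar i m (Suc m) j) (root i m) (rroot j (Suc m))"
      using assms False by (intro root_rroot_far) auto
    from qcomm_br_right[OF this 1] show ?thesis
      using False assms bichar_split_right[of m "Suc m" j i m] by (simp add: mixed_def e mult_ac)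
  qed
  then have "qcomm (p * bichar i m m j) (root i m) (bichar i m (Suc m) j \<cdot> mixed i (Suc m) j)"
    by (rule qcomm_scl_right)
  then show ?thesis
    using qcomm_cong[OF eqv_refl mixed_Suc[OF assms]] by blast
qed

text \<open>By \<open>serre_opposite\<close> it suffices to bracket x_jm with [x_jm, x_im]. Reading
  \<open>mixed_Suc\<close> backwards at l = m - 1, the latter is up to a scalar [x_il, x_jl], or
  x_ji if l = i, and x_jm q-commutes with all of these.\<close>

lemma pair_serre_right:
  assumes "1 \<le> i" "i < m" "m < j" "j \<le> Suc n"
  shows "qcomm (p * bichar i m m j) (br (bichar i m m j) (root i m) (rroot j m)) (rroot j m)"
proof (rule serre_opposite)
  show "bichar i m m j * bichar m j i m * p = 1"
    using assms by (intro bichar_adj) auto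
  obtain l where l: "m = Suc l"
    using assms by (cases m) auto
  have 1: "qcomm (bichar m j l j) (rroot j m) (rroot j l)"
    using assms rroot_rroot_Suc[of l j] by (simp add: l)
  have e: "bichar m j l j = bichar m j l m * p"
    using assms bichar_split_right[of l m j m j] by (simp add: l bichar_self)
  show "qcomm (p * bichar m j i m) (rroot j m) (br (bichar m j i m) (rroot j m) (root i m))"
  proof (cases "l = i")
    case True
    then show ?thesis
      using 1 e rroot_split[of i m j] assms qcomm_cong[OF eqv_refl rroot_split[of i m j]]
      by (simp add: l mult.commute)
  next
    case False
    have g: "bichar i l m j * bichar m j i l = 1"
      using assms False by (intro bichar_far) (auto simp: l)
    have "qcomm (bichar m j i l) (rroot j m) (root i l)"
    proof (rule qcomm_sym[OF _ g])
      show "qcomm (bichar i l m j) (root i l) (rroot j m)"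
        using assms False by (intro root_rroot_far) (auto simp: l)
    qed
    from qcomm_br_right[OF this 1, of "bichar i l l j"]
    have "qcomm (p * bichar m j i m) (rroot j m) (br (bichar i l l j) (root i l) (rroot j l))"
    proof -
      have "bichar m j i m = bichar m j i l * bichar m j l m"
        using assms False by (intro bichar_split_right) (auto simp: l)
      then have "bichar m j i l * bichar m j l j = p * bichar m j i m"
        by (simp add: e mult_ac)
      then show ?thesis
        using \<open>qcomm (bichar m j i l * bichar m j l j) _ _\<close> by simp
    qed
    then have "qcomm (p * bichar m j i m) (rroot j m) (bichar i l m j \<cdot> mixed i m j)"
      using mixed_Suc[of i l j] assms False qcomm_cong[OF eqv_refl mixed_Suc[of i l j]]
      by (simp add: l)
    \<comment> \<open>By \<open>g\<close> this scalar is inverse to \<open>bichar i l m j\<close>,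
      so the factor in front of \<open>mixed i m j\<close> disappears.\<close>
    from qcomm_scl_right[OF this, of "bichar m j i l"] show ?thesis
      using assms g by (simp add: scl_scl scl_one mixed_def mult.commute)
  qed
qed

text \<open>The scalar collected while telescoping from i + 1 to \<open>m\<close>; for the datum it
  is \<tau>_im, see \<open>twist_eq\<close>.\<close>

definition twist :: "nat \<Rightarrow> nat \<Rightarrow> nat \<Rightarrow> 'k" where
  "twist N i m = (\<Prod>r\<in>{Suc i..<m}. bichar r (Suc r) i r ^ N)"

lemma twist_Suc: "i < m \<Longrightarrow> twist N i (Suc m) = twist N i m * bichar m (Suc m) i m ^ N"
  by (simp add: twist_def)

text \<open>For each \<open>k\<close>, \<open>serre_power\<close> with a = x_ik and b = x_jk trades
  the power of \<open>mixed i k j\<close> for a product x_jk^N x_ik^N and the power of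
  \<open>mixed i (Suc k) j\<close>. Starting at x_ji, the process ends with x_ij at k = j.\<close>

theorem rroot_power:
  assumes ij: "1 \<le> i" "i < j" "j \<le> Suc n"
    and N: "p ^ N = 1" "\<And>l. 0 < l \<Longrightarrow> l < N \<Longrightarrow> p ^ l \<noteq> 1" "odd N"
  shows "rroot j i ^ N \<approx> ((- 1) ^ (j - Suc i) * twist N i j) \<cdot> root i j ^ N
     + (\<Sum>m\<in>{Suc i..<j}. ((- 1) ^ (m - Suc i) * twist N i m * (p - 1) ^ N
          * bichar i m m j ^ (N * ((N - 1) div 2))) \<cdot> (rroot j m ^ N * root i m ^ N))"
proof -
  define c where "c m = (p - 1) ^ N * bichar i m m j ^ (N * ((N - 1) div 2))" for m
  have "rroot j i ^ N \<approx> ((- 1) ^ (k - Suc i) * twist N i k) \<cdot> mixed i k j ^ N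
     + (\<Sum>m\<in>{Suc i..<k}. ((- 1) ^ (m - Suc i) * twist N i m * c m) \<cdot> (rroot j m ^ N * root i m ^ N))"
    if "Suc i \<le> k" "k \<le> j" for k
    using that
  proof (induction k rule: nat_induct_at_least)
    case base
    show ?case
      using eqv_power[OF mixed_first[OF ij]] by (simp add: scl_one twist_def)
  next
    case (Suc k)
    let ?A = "br (bichar i k k j) (root i k) (rroot j k)"
    let ?e = "(- 1) ^ (k - Suc i) * twist N i k"
    have k: "i < k" "k < j"
      using Suc by auto
    have "c k \<cdot> (rroot j k ^ N * root i k ^ N)
        \<approx> br (bichar k j i k) (rroot j k) (root i k) ^ N + bichar k j i k ^ N \<cdot> ?A ^ N"
      unfolding c_def using ij k N
      by (intro serre_power pair_serre_left pair_serre_right bichar_adj) auto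
    then have "mixed i k j ^ N \<approx> c k \<cdot> (rroot j k ^ N * root i k ^ N) - bichar k j i k ^ N \<cdot> ?A ^ N"
      using k eqv_sym by (simp add: mixed_def eqv_def algebra_simps)
    also have "\<dots> \<approx> c k \<cdot> (rroot j k ^ N * root i k ^ N)
        - bichar k j i k ^ N \<cdot> (bichar i k (Suc k) j \<cdot> mixed i (Suc k) j) ^ N"
      using ij k by (intro eqv_diff eqv_refl eqv_scl eqv_power mixed_Suc) auto
    finally have "mixed i k j ^ N \<approx> c k \<cdot> (rroot j k ^ N * root i k ^ N)
        - (bichar k j i k * bichar i k (Suc k) j) ^ N \<cdot> mixed i (Suc k) j ^ N"
      by (simp add: scl_power scl_scl power_mult_distrib)
    \<comment> \<open>Splitting the letter \<open>k\<close> off x_jk leaves two mutually inverse far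
      factors, so the scalar no longer depends on \<open>j\<close>.\<close>
    also have "bichar k j i k * bichar i k (Suc k) j
        = bichar k (Suc k) i k * (bichar i k (Suc k) j * bichar (Suc k) j i k)"
      using k by (simp add: bichar_split_left[of k "Suc k" j])
    also have "bichar i k (Suc k) j * bichar (Suc k) j i k = 1"
      using ij k by (intro bichar_far) auto
    finally have "?e \<cdot> mixed i k j ^ N
       \<approx> ?e \<cdot> (c k \<cdot> (rroot j k ^ N * root i k ^ N) - bichar k (Suc k) i k ^ N \<cdot> mixed i (Suc k) j ^ N)"
      by (intro eqv_scl) simp
    also have "\<dots> = (?e * c k) \<cdot> (rroot j k ^ N * root i k ^ N)
       + ((- 1) ^ (Suc k - Suc i) * twist N i (Suc k)) \<cdot> mixed i (Suc k) j ^ N"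
      using k by (simp add: scl_simps twist_Suc mult.assoc flip: Suc_diff_Suc)
    finally have step: "?e \<cdot> mixed i k j ^ N \<approx> \<dots>" .
    have "rroot j i ^ N \<approx> ?e \<cdot> mixed i k j ^ N
       + (\<Sum>m\<in>{Suc i..<k}. ((- 1) ^ (m - Suc i) * twist N i m * c m) \<cdot> (rroot j m ^ N * root i m ^ N))"
      using Suc by simp
    also have "\<dots> \<approx> (?e * c k) \<cdot> (rroot j k ^ N * root i k ^ N)
       + ((- 1) ^ (Suc k - Suc i) * twist N i (Suc k)) \<cdot> mixed i (Suc k) j ^ N
       + (\<Sum>m\<in>{Suc i..<k}. ((- 1) ^ (m - Suc i) * twist N i m * c m) \<cdot> (rroot j m ^ N * root i m ^ N))"
      by (intro eqv_add step eqv_refl)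
    finally show ?case
      using Suc by (simp add: add_ac)
  qed
  from this[of j] show ?thesis
    using ij by (simp add: mixed_def c_def mult.assoc)
qed

end

section \<open>Sums over chains\<close>

lemma chainsD:
  assumes "c \<in> chains i j"
  shows "2 \<le> length c" "sorted_wrt (<) c" "c \<noteq> []" "hd c = i" "last c = j" "x \<in> set c \<Longrightarrow> i \<le> x \<and> x \<le> j"
proof -
  show *: "2 \<le> length c" "sorted_wrt (<) c" "c \<noteq> []" "hd c = i" "last c = j"
    using assms by (auto simp: chains_def)
  show "i \<le> x \<and> x \<le> j" if x: "x \<in> set c"
  proof
    obtain d where d: "c = i # d"
      using *(3,4) by (cases c) auto
    show "i \<le> x"
      using *(2) x unfolding d by auto
    obtain e where e: "c = e @ [j]"
      using *(3,5) by (metis append_butlast_last_id)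
    show "x \<le> j"
      using *(2) x unfolding e by (auto simp: sorted_wrt_append)
  qed
qed

lemma chains_less: "c \<in> chains i j \<Longrightarrow> i < j"
proof -
  assume c: "c \<in> chains i j"
  then obtain d where d: "c = i # d" "d \<noteq> []"
    using chainsD(1,3,4)[OF c] by (cases c; force)
  then have "j \<in> set d"
    using chainsD(5)[OF c] by auto
  then show "i < j"
    using chainsD(2)[OF c] d by auto
qed

lemma chains_snoc_iff: "c @ [j] \<in> chains i j \<longleftrightarrow> (c = [i] \<and> i < j) \<or> (\<exists>k\<in>{Suc i..<j}. c \<in> chains i k)"
proof
  assume cj: "c @ [j] \<in> chains i j"
  then have c: "c \<noteq> []" "sorted_wrt (<) c" "hd c = i" "\<forall>x\<in>set c. x < j"
    by (auto simp: chains_def sorted_wrt_append hd_append split: if_splits)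
  show "(c = [i] \<and> i < j) \<or> (\<exists>k\<in>{Suc i..<j}. c \<in> chains i k)"
  proof (cases "length c \<ge> 2")
    case True
    then have "c \<in> chains i (last c)"
      using c by (auto simp: chains_def)
    moreover from this have "i < last c"
      by (rule chains_less)
    ultimately show ?thesis
      using c by auto
  next
    case False
    then have "c = [i]"
      using c by (cases c) (auto simp: not_le less_Suc_eq)
    then show ?thesis
      using c by auto
  qed
next
  assume "(c = [i] \<and> i < j) \<or> (\<exists>k\<in>{Suc i..<j}. c \<in> chains i k)"
  then show "c @ [j] \<in> chains i j"
  proof
    assume "\<exists>k\<in>{Suc i..<j}. c \<in> chains i k"
    then obtain k where k: "k < j" "c \<in> chains i k"
      by auto
    then show ?thesis
      using chainsD[OF k(2)] by (auto simp: chains_def sorted_wrt_append intro: le_less_trans)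
  qed (auto simp: chains_def)
qed

text \<open>Deleting the last entry of a chain leaves \<open>[i]\<close> or a chain that ends at the
  penultimate entry \<open>k\<close>; distinct \<open>k\<close> give disjoint sets.\<close>

lemma sum_chains:
  assumes "i < j"
  shows "(\<Sum>c\<in>chains i j. f c) = f [i, j] + (\<Sum>k\<in>{Suc i..<j}. \<Sum>c\<in>chains i k. f (c @ [j]))"
proof -
  let ?U = "\<Union>k\<in>{Suc i..<j}. chains i k"
  have eq: "chains i j = (\<lambda>c. c @ [j]) ` insert [i] ?U"
  proof (intro equalityI subsetI)
    fix c assume c: "c \<in> chains i j"
    then have "c = butlast c @ [j]"
      using chainsD(3,5)[OF c] by (metis append_butlast_last_id)
    with c chains_snoc_iff[of "butlast c" j i] show "c \<in> (\<lambda>c. c @ [j]) ` insert [i] ?U"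
      by (auto simp: image_iff)
  next
    fix c assume "c \<in> (\<lambda>c. c @ [j]) ` insert [i] ?U"
    then obtain d where "c = d @ [j]" "d \<in> insert [i] ?U"
      by blast
    then show "c \<in> chains i j"
      using chains_snoc_iff[of d j i] assms by auto
  qed
  have disj: "\<forall>k\<in>{Suc i..<j}. \<forall>l\<in>{Suc i..<j}. k \<noteq> l \<longrightarrow> chains i k \<inter> chains i l = {}"
    using chainsD(5) by blast
  have "[i] \<notin> ?U"
    by (auto simp: chains_def)
  have "(\<Sum>c\<in>chains i j. f c) = (\<Sum>c\<in>insert [i] ?U. f (c @ [j]))"
    unfolding eq by (subst sum.reindex) (auto simp: inj_on_def)
  also have "\<dots> = f [i, j] + (\<Sum>c\<in>?U. f (c @ [j]))"
    using \<open>[i] \<notin> ?U\<close> by (subst sum.insert) (auto simp: finite_chains)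
  also have "(\<Sum>c\<in>?U. f (c @ [j])) = (\<Sum>k\<in>{Suc i..<j}. \<Sum>c\<in>chains i k. f (c @ [j]))"
    using disj by (intro sum.UNION_disjoint) (auto simp: finite_chains)
  finally show ?thesis .
qed

lemma chain_prod_snoc: "c \<noteq> [] \<Longrightarrow> chain_prod \<mu> (c @ [j]) = chain_prod \<mu> c * \<mu> (last c) j"
proof -
  assume "c \<noteq> []"
  then obtain m where m: "length c = Suc m"
    by (cases c) auto
  then have "last c = c ! m"
    using \<open>c \<noteq> []\<close> by (simp add: last_conv_nth)
  moreover have "(\<Prod>s<m. \<mu> ((c @ [j]) ! s) ((c @ [j]) ! Suc s)) = (\<Prod>s<m. \<mu> (c ! s) (c ! Suc s))"
    using m by (intro prod.cong) (auto simp: nth_append)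
  ultimately show ?thesis
    by (simp add: chain_prod_def m nth_append)
qed

section \<open>Chain sums and unitriangular matrices\<close>

definition chain_sum :: "'k::field \<Rightarrow> (nat \<Rightarrow> nat \<Rightarrow> 'k) \<Rightarrow> nat \<Rightarrow> nat \<Rightarrow> 'k" where
  "chain_sum s \<mu> i j = (\<Sum>c\<in>chains i j. s ^ (length c - 2) * chain_prod \<mu> c)"

lemma chain_sum_snoc:
  assumes "c \<in> chains i k"
  shows "s ^ (length (c @ [j]) - 2) * chain_prod \<mu> (c @ [j]) = s ^ (length c - 2) * chain_prod \<mu> c * (s * \<mu> k j)"
proof -
  have "length (c @ [j]) - 2 = Suc (length c - 2)"
    using chainsD(1)[OF assms] by simp
  then show ?thesis
    using chainsD(3,5)[OF assms] by (simp add: chain_prod_snoc)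
qed

text \<open>The last step of each chain is split off. For strictly upper triangular matrices this
  reads C = \<mu> + s C \<mu>, so 1 + s C is the inverse of 1 - s \<mu>.\<close>

lemma chain_sum_rec:
  assumes "i < j"
  shows "chain_sum s \<mu> i j = \<mu> i j + s * (\<Sum>k\<in>{Suc i..<j}. chain_sum s \<mu> i k * \<mu> k j)"
proof -
  have "(\<Sum>c\<in>chains i k. s ^ (length (c @ [j]) - 2) * chain_prod \<mu> (c @ [j])) = s * (chain_sum s \<mu> i k * \<mu> k j)" for k
    by (subst sum.cong[OF refl chain_sum_snoc])
      (simp_all add: chain_sum_def sum_distrib_left sum_distrib_right mult_ac)
  then show ?thesis
    unfolding chain_sum_def[of s \<mu> i j] sum_chains[OF assms]
    by (simp add: sum_distrib_left chain_prod_def)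
qed

definition unitri :: "'k::field \<Rightarrow> (nat \<Rightarrow> nat \<Rightarrow> 'k) \<Rightarrow> nat \<Rightarrow> nat \<Rightarrow> 'k" where
  "unitri s a i j = (if i = j then 1 else if i < j then s * a i j else 0)"

text \<open>Chains are grouped by their penultimate entry \<open>k\<close>, on which alone the group
  element depends. The chain \<open>[i, j]\<close> is the summand k = i, where \<open>unitri\<close>
  has its diagonal entry 1.\<close>

lemma u_elem_unitri:
  fixes D :: "('g, 'k::field) datum"
  assumes "i < j"
  defines "s \<equiv> (par D - 1) ^ ordr D"
  shows "u_elem D \<mu> i j = (\<Sum>k\<in>{i..<j}.
    Poly_Mapping.single \<one>\<^bsub>grp D\<^esub> (unitri s (chain_sum s \<mu>) i k * \<mu> k j)
    - Poly_Mapping.single (elt_root D k j [^]\<^bsub>grp D\<^esub> ordr D) (unitri s (chain_sum s \<mu>) i k * \<mu> k j))"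
proof -
  define t :: "nat \<Rightarrow> 'k \<Rightarrow> ('g \<Rightarrow>\<^sub>0 'k)" where "t k a = Poly_Mapping.single \<one>\<^bsub>grp D\<^esub> a - Poly_Mapping.single (elt_root D k j [^]\<^bsub>grp D\<^esub> ordr D) a" for k a
  have t_sum: "t k (sum f A) = (\<Sum>a\<in>A. t k (f a))" for k f and A :: "nat list set"
    by (induction A rule: infinite_finite_induct) (auto simp: t_def single_add)
  have "u_elem D \<mu> i j = (\<Sum>c\<in>chains i j. t (c ! (length c - 2)) (s ^ (length c - 2) * chain_prod \<mu> c))"
    unfolding u_elem_def t_def s_def Let_def power_mult
    by (intro sum.cong refl) (simp add: chainsD(5))
  also have "\<dots> = t i (\<mu> i j) + (\<Sum>k\<in>{Suc i..<j}. \<Sum>c\<in>chains i k.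
      t ((c @ [j]) ! (length (c @ [j]) - 2)) (s ^ (length (c @ [j]) - 2) * chain_prod \<mu> (c @ [j])))"
    unfolding sum_chains[OF assms(1)] by (simp add: chain_prod_def)
  also have "(\<Sum>k\<in>{Suc i..<j}. \<Sum>c\<in>chains i k.
      t ((c @ [j]) ! (length (c @ [j]) - 2)) (s ^ (length (c @ [j]) - 2) * chain_prod \<mu> (c @ [j])))
    = (\<Sum>k\<in>{Suc i..<j}. t k (s * chain_sum s \<mu> i k * \<mu> k j))"
  proof (intro sum.cong refl)
    fix k
    have "t ((c @ [j]) ! (length (c @ [j]) - 2)) (s ^ (length (c @ [j]) - 2) * chain_prod \<mu> (c @ [j]))
      = t k (s ^ (length c - 2) * chain_prod \<mu> c * (s * \<mu> k j))" if "c \<in> chains i k" for c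
    proof -
      have "(c @ [j]) ! (length (c @ [j]) - 2) = k"
        using chainsD[OF that] by (auto simp: nth_append last_conv_nth numeral_2_eq_2)
      then show ?thesis
        by (simp only: chain_sum_snoc[OF that])
    qed
    then show "(\<Sum>c\<in>chains i k. t ((c @ [j]) ! (length (c @ [j]) - 2)) (s ^ (length (c @ [j]) - 2) * chain_prod \<mu> (c @ [j])))
      = t k (s * chain_sum s \<mu> i k * \<mu> k j)"
      by (simp add: t_sum[symmetric] chain_sum_def sum_distrib_left sum_distrib_right mult_ac)
  qed
  also have "t i (\<mu> i j) + (\<Sum>k\<in>{Suc i..<j}. t k (s * chain_sum s \<mu> i k * \<mu> k j))
    = (\<Sum>k\<in>{i..<j}. t k (unitri s (chain_sum s \<mu>) i k * \<mu> k j))"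
    unfolding sum.atLeast_Suc_lessThan[OF assms(1)]
    by (intro arg_cong2[of _ _ _ _ "(+)"] sum.cong) (auto simp: unitri_def)
  finally show ?thesis
    by (simp add: t_def)
qed

lemma tilde_tilde: "i \<le> n + 2 \<Longrightarrow> tilde n (tilde n i) = i"
  by (simp add: tilde_def)

lemma rev_tilde_chains:
  assumes "c \<in> chains i j" "j \<le> n + 2"
  shows "rev (map (tilde n) c) \<in> chains (tilde n j) (tilde n i)"
    and "rev (map (tilde n) (rev (map (tilde n) c))) = c"
proof -
  note c = chainsD[OF assms(1)]
  have "sorted_wrt (\<lambda>x y. tilde n y < tilde n x) c"
    using c(2) by (rule sorted_wrt_mono_rel[rotated]) (use c(6) assms(2) in \<open>force simp: tilde_def\<close>)
  then show "rev (map (tilde n) c) \<in> chains (tilde n j) (tilde n i)"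
    using c(1,3,4,5) by (simp add: chains_def sorted_wrt_rev sorted_wrt_map hd_rev last_rev last_map hd_map)
  show "rev (map (tilde n) (rev (map (tilde n) c))) = c"
    using c(6) assms(2) by (force simp: rev_map tilde_tilde intro: map_idI)
qed

text \<open>Since \<open>tilde\<close> reverses the order, reflecting a chain and reading it
  backwards is a bijection between the two sets of chains.\<close>

lemma chain_sum_tilde:
  assumes "i \<le> n + 2" "j \<le> n + 2"
  shows "(\<Sum>c\<in>chains (tilde n j) (tilde n i). s ^ (length c - 2) * chain_prod \<mu> (rev (map (tilde n) c)))
    = chain_sum s \<mu> i j"
  unfolding chain_sum_def
  by (rule sum.reindex_bij_witness[of _ "\<lambda>c. rev (map (tilde n) c)" "\<lambda>c. rev (map (tilde n) c)"])
    (use assms rev_tilde_chains[of _ "tilde n j" "tilde n i" n] rev_tilde_chains[of _ i j n] in \<open>auto simp: tilde_tilde tilde_def\<close>)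

text \<open>Let X be column \<open>j\<close> of the product m w and e_j the unit column. From w m =
  1 follows w X = w e_j, and the unitriangular system is solved from the last row upwards, hence the
  induction on \<open>K - i\<close>.\<close>

lemma unitri_right_inverse:
  fixes w m :: "nat \<Rightarrow> nat \<Rightarrow> 'k::field"
  assumes w: "\<And>i. w i i = 1" "\<And>i j. j < i \<Longrightarrow> w i j = 0"
    and wm: "\<And>i j. i \<in> {1..K} \<Longrightarrow> j \<in> {1..K} \<Longrightarrow> (\<Sum>k\<in>{1..K}. w i k * m k j) = (if i = j then 1 else 0)"
    and ij: "i \<in> {1..K}" "j \<in> {1..K}"
  shows "(\<Sum>k\<in>{1..K}. m i k * w k j) = (if i = j then 1 else 0)"
  using ij(1)
proof (induction "K - i" arbitrary: i rule: less_induct)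
  case less
  define X where "X i = (\<Sum>k\<in>{1..K}. m i k * w k j)" for i
  have "(\<Sum>k\<in>{1..K}. w i k * X k) = (\<Sum>l\<in>{1..K}. (\<Sum>k\<in>{1..K}. w i k * m k l) * w l j)"
    unfolding X_def sum_distrib_left sum_distrib_right by (subst sum.swap) (simp add: mult.assoc)
  also have "\<dots> = (\<Sum>l\<in>{1..K}. if l = i then w l j else 0)"
    using less.prems by (intro sum.cong refl) (simp add: wm[OF less.prems] del: One_nat_def)
  also have "\<dots> = w i j"
    using less.prems by simp
  finally have "(\<Sum>k\<in>{1..K}. w i k * X k) = w i j" .
  moreover have "(\<Sum>k\<in>{1..K}. w i k * X k) = (\<Sum>k\<in>{1..K}. if k = i then X i - (if i = j then 1 else 0) else 0)
      + (\<Sum>k\<in>{1..K}. if k = j then w i j else 0)"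
    unfolding sum.distrib[symmetric]
  proof (intro sum.cong refl)
    fix k assume k: "k \<in> {1..K}"
    show "w i k * X k = (if k = i then X i - (if i = j then 1 else 0) else 0) + (if k = j then w i j else 0)"
    proof (cases "i < k")
      case True
      then have "X k = (if k = j then 1 else 0)"
        unfolding X_def using less k by auto
      then show ?thesis
        using True by auto
    next
      case False
      then show ?thesis
        using w by (cases "k = i") auto
    qed
  qed
  ultimately show ?case
    using less.prems ij(2) by (simp add: X_def)
qed

section \<open>The family \<open>\<sigma>(\<mu>)\<close>\<close>

locale datum_family =
  fixes n :: nat and D :: "('g, 'k::field_char_0) datum"
    and \<mu> :: "nat \<Rightarrow> nat \<Rightarrow> 'k"
  assumes datum: "datum_type_A n D" and R2: "R2 n D \<mu>"
begin

abbreviation "N \<equiv> ordr D"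

definition s :: 'k where "s = (par D - 1) ^ N"

definition trivial_char :: "nat \<Rightarrow> nat \<Rightarrow> bool" where
  "trivial_char i j \<longleftrightarrow> (\<forall>h\<in>carrier (grp D). chr_root D i j h ^ N = 1)"

abbreviation "M \<equiv> chain_sum s \<mu>"

sublocale grp: comm_group "grp D"
  using datum by (simp add: datum_type_A_def)

lemma elt_closed [simp]: "i \<in> {1..n} \<Longrightarrow> elt D i \<in> carrier (grp D)"
  and chr_hom: "i \<in> {1..n} \<Longrightarrow> chr D i \<in> hom (grp D) mult_group_of_field"
  and N_gt: "N > 1" and N_odd: "odd N" and par_pow: "par D ^ N = 1"
  and par_order: "0 < l \<Longrightarrow> l < N \<Longrightarrow> par D ^ l \<noteq> 1"
  and qq_diag: "i \<in> {1..n} \<Longrightarrow> qq D i i = par D"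
  using datum by (simp_all add: datum_type_A_def)

lemma qq_adj: "i \<in> {1..n} \<Longrightarrow> j \<in> {1..n} \<Longrightarrow> i = Suc j \<or> j = Suc i \<Longrightarrow> qq D i j * qq D j i = inverse (par D)"
  and qq_far: "i \<in> {1..n} \<Longrightarrow> j \<in> {1..n} \<Longrightarrow> Suc i < j \<or> Suc j < i \<Longrightarrow> qq D i j * qq D j i = 1"
  using datum unfolding datum_type_A_def by blast+

lemma par_nonzero: "par D \<noteq> 0"
  using par_pow N_gt by (cases N) auto

lemma s_nonzero: "s \<noteq> 0"
  using par_order[of 1] N_gt by (simp add: s_def)

text \<open>An odd order excludes q = -1.\<close>

lemma one_plus_par: "1 + par D \<noteq> 0"
proof
  assume "1 + par D = 0"
  then have "par D = - 1"
    by (simp add: add_eq_0_iff)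
  then have "(1::'k) = - 1"
    using par_pow N_odd by simp
  then show False
    by simp
qed

text \<open>Each product q_ij q_ji is a power of \<open>q\<close>, whose N-th power is 1.\<close>

lemma qq_pow:
  assumes "i \<in> {1..n}" "j \<in> {1..n}"
  shows "qq D i j ^ N * qq D j i ^ N = 1"
proof -
  consider "i = j" | "i = Suc j \<or> j = Suc i" | "Suc i < j \<or> Suc j < i"
    by linarith
  then have "(qq D i j * qq D j i) ^ N = 1"
    using assms par_pow qq_diag qq_adj qq_far
    by cases (simp_all add: power_mult_distrib power_inverse del: atLeastAtMost_iff)
  then show ?thesis
    by (simp add: power_mult_distrib)
qed

lemma chr_mult:
  assumes "i \<in> {1..n}" "g \<in> carrier (grp D)" "h \<in> carrier (grp D)"
  shows "chr D i (g \<otimes>\<^bsub>grp D\<^esub> h) = chr D i g * chr D i h"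
  using hom_mult[OF chr_hom[OF assms(1)] assms(2,3)] by (simp add: mult_group_of_field_def)

lemma chr_one:
  assumes "i \<in> {1..n}"
  shows "chr D i \<one>\<^bsub>grp D\<^esub> = 1"
proof -
  have "chr D i \<one>\<^bsub>grp D\<^esub> \<noteq> 0"
    using hom_in_carrier[OF chr_hom[OF assms], of "\<one>\<^bsub>grp D\<^esub>"] by (simp add: mult_group_of_field_def)
  moreover have "chr D i \<one>\<^bsub>grp D\<^esub> = chr D i \<one>\<^bsub>grp D\<^esub> * chr D i \<one>\<^bsub>grp D\<^esub>"
    using chr_mult[OF assms, of "\<one>\<^bsub>grp D\<^esub>" "\<one>\<^bsub>grp D\<^esub>"] by simp
  ultimately show ?thesis
    by simp
qed

lemma elt_root_closed [simp]: "1 \<le> i \<Longrightarrow> j \<le> Suc n \<Longrightarrow> elt_root D i j \<in> carrier (grp D)"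
  unfolding elt_root_def by (intro grp.finprod_closed) auto

lemma elt_root_concat:
  assumes "1 \<le> i" "i \<le> k" "k \<le> j" "j \<le> Suc n"
  shows "elt_root D i j = elt_root D i k \<otimes>\<^bsub>grp D\<^esub> elt_root D k j"
proof -
  have "elt_root D i j = finprod (grp D) (elt D) ({i..<k} \<union> {k..<j})"
    using assms by (simp add: elt_root_def ivl_disj_un_two)
  also have "\<dots> = elt_root D i k \<otimes>\<^bsub>grp D\<^esub> elt_root D k j"
    unfolding elt_root_def using assms by (intro grp.finprod_Un_disjoint) auto
  finally show ?thesis .
qed

lemma chr_elt_root:
  assumes "t \<in> {1..n}" "1 \<le> i" "j \<le> Suc n"
  shows "chr D t (elt_root D i j) = (\<Prod>s\<in>{i..<j}. qq D s t)"
proof -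
  have "chr D t (finprod (grp D) (elt D) A) = (\<Prod>s\<in>A. qq D s t)" if "finite A" "A \<subseteq> {1..n}" for A
    using that
  proof (induction A)
    case (insert a A)
    then have "elt D \<in> A \<rightarrow> carrier (grp D)" "elt D a \<in> carrier (grp D)"
      by auto
    with insert show ?case
      using assms(1) by (simp add: chr_mult qq_def)
  qed (use chr_one[OF assms(1)] in simp)
  moreover have "{i..<j} \<subseteq> {1..n}"
    using assms by auto
  ultimately show ?thesis
    unfolding elt_root_def by blast
qed

lemma chr_root_elt_root:
  assumes "1 \<le> i" "j \<le> Suc n" "1 \<le> k" "l \<le> Suc n"
  shows "chr_root D k l (elt_root D i j) = (\<Prod>s\<in>{i..<j}. \<Prod>t\<in>{k..<l}. qq D s t)"
proof -
  have "chr_root D k l (elt_root D i j) = (\<Prod>t\<in>{k..<l}. \<Prod>s\<in>{i..<j}. qq D s t)"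
    unfolding chr_root_def using assms by (intro prod.cong refl chr_elt_root) auto
  then show ?thesis
    by (subst prod.swap)
qed

section \<open>Trivial characters and multiplicativity of \<tau>\<close>

lemma trivial_char_trans:
  assumes "trivial_char i k" "trivial_char k j" "i \<le> k" "k \<le> j"
  shows "trivial_char i j"
proof -
  have "chr_root D i j h = chr_root D i k h * chr_root D k j h" for h
    using assms(3,4) by (simp add: chr_root_def prod.atLeastLessThan_concat)
  then show ?thesis
    using assms(1,2) by (simp add: trivial_char_def power_mult_distrib)
qed

lemma trivial_char_mu:
  "1 \<le> i \<Longrightarrow> i < j \<Longrightarrow> j \<le> Suc n \<Longrightarrow> \<mu> i j \<noteq> 0 \<Longrightarrow> trivial_char i j"
  using R2 unfolding R2_def trivial_char_def by (metis Suc_eq_plus1)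

text \<open>A non-zero chain sum contains a chain all of whose steps have non-zero \<mu>, hence
  trivial chi^N by (R2), and characters multiply along the chain.\<close>

lemma trivial_char_M:
  assumes "1 \<le> i" "i < j" "j \<le> Suc n" "M i j \<noteq> 0"
  shows "trivial_char i j"
  using assms(2-)
proof (induction j rule: less_induct)
  case (less j)
  show ?case
  proof (cases "\<mu> i j = 0")
    case False
    then show ?thesis
      using less assms by (intro trivial_char_mu) auto
  next
    case True
    then have "(\<Sum>k\<in>{Suc i..<j}. M i k * \<mu> k j) \<noteq> 0"
      using less.prems chain_sum_rec[of i j s \<mu>] by auto
    then obtain k where k: "k \<in> {Suc i..<j}" "M i k * \<mu> k j \<noteq> 0"
      by (meson sum.neutral)
    then have "trivial_char i k"
      using less by auto
    moreover have "trivial_char k j"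
      using k less assms by (intro trivial_char_mu) auto
    ultimately show ?thesis
      using k by (intro trivial_char_trans[of i k j]) auto
  qed
qed

text \<open>The first product is chi_ik^N evaluated at g_lj; the second is its inverse by
  \<open>qq_pow\<close>.\<close>

lemma trivial_char_qq:
  assumes "trivial_char i k" "1 \<le> i" "k \<le> Suc n" "1 \<le> l" "j \<le> Suc n"
  shows "(\<Prod>t\<in>{l..<j}. \<Prod>r\<in>{i..<k}. qq D t r ^ N) = 1"
    and "(\<Prod>r\<in>{i..<k}. \<Prod>t\<in>{l..<j}. qq D r t ^ N) = 1"
proof -
  have "chr_root D i k (elt_root D l j) ^ N = 1"
    using assms by (simp add: trivial_char_def)
  then show *: "(\<Prod>t\<in>{l..<j}. \<Prod>r\<in>{i..<k}. qq D t r ^ N) = 1"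
    using assms by (simp add: chr_root_elt_root flip: prod_power_distrib)
  have "(\<Prod>t\<in>{l..<j}. \<Prod>r\<in>{i..<k}. qq D t r ^ N) * (\<Prod>r\<in>{i..<k}. \<Prod>t\<in>{l..<j}. qq D r t ^ N)
      = (\<Prod>t\<in>{l..<j}. \<Prod>r\<in>{i..<k}. qq D t r ^ N * qq D r t ^ N)"
    by (subst (2) prod.swap) (simp add: prod.distrib)
  also have "\<dots> = 1"
    using assms by (intro prod.neutral ballI qq_pow) auto
  finally show "(\<Prod>r\<in>{i..<k}. \<Prod>t\<in>{l..<j}. qq D r t ^ N) = 1"
    by (simp add: *)
qed

lemma tau_prod: "tau D i j = (\<Prod>l\<in>{i..<j}. \<Prod>k\<in>{i..<l}. qq D l k ^ N)"
proof -
  have "tau D i j = (\<Prod>(l, k)\<in>(SIGMA l:{i..<j}. {i..<l}). qq D l k ^ N)"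
    unfolding tau_def by (rule prod.reindex_bij_witness[of _ prod.swap prod.swap]) auto
  then show ?thesis
    by (simp add: prod.Sigma)
qed

text \<open>The quotient of the two sides consists of the cross terms between the intervals, which
  form chi_ik(g_kj)^N.\<close>

lemma tau_mult:
  assumes "trivial_char i k" "1 \<le> i" "i \<le> k" "k \<le> j" "j \<le> Suc n"
  shows "tau D i j = tau D i k * tau D k j"
proof -
  have "tau D i j = tau D i k * (\<Prod>l\<in>{k..<j}. \<Prod>r\<in>{i..<l}. qq D l r ^ N)"
    using assms by (simp add: tau_prod prod.atLeastLessThan_concat)
  also have "(\<Prod>l\<in>{k..<j}. \<Prod>r\<in>{i..<l}. qq D l r ^ N)
      = (\<Prod>l\<in>{k..<j}. \<Prod>r\<in>{i..<k}. qq D l r ^ N) * tau D k j"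
    using assms(3) unfolding tau_prod prod.distrib[symmetric]
    by (intro prod.cong refl) (simp add: prod.atLeastLessThan_concat)
  also have "(\<Prod>l\<in>{k..<j}. \<Prod>r\<in>{i..<k}. qq D l r ^ N) = 1"
    using assms by (intro trivial_char_qq) auto
  finally show ?thesis
    by simp
qed

section \<open>The twisted families and their matrices\<close>

definition \<nu> :: "nat \<Rightarrow> nat \<Rightarrow> 'k" where
  "\<nu> i j = (- 1) ^ (j - Suc i) * tau D i j * \<mu> i j"

text \<open>Read through the reflection, \<open>S\<close> is \<sigma>(\<mu>) and
  \<open>\<nu>\<close> is the family of its chain sums; see \<open>sigma_fam_tilde\<close> and
  \<open>chain_sum_sigma\<close>.\<close>

definition S :: "nat \<Rightarrow> nat \<Rightarrow> 'k" where
  "S i j = (- 1) ^ (j - Suc i) * tau D i j * M i j"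

lemma sign_split: "i < k \<Longrightarrow> k < j \<Longrightarrow> (- 1 :: 'k) ^ (j - Suc i) = - ((- 1) ^ (k - Suc i) * (- 1) ^ (j - Suc k))"
proof -
  assume "i < k" "k < j"
  then have "j - Suc i = Suc ((k - Suc i) + (j - Suc k))"
    by simp
  then show ?thesis
    by (simp only: power_Suc power_add) simp
qed

text \<open>If \<open>M i k\<close> is zero both sides vanish; otherwise chi_ik^N is trivial and
  \<tau>_ij factors at \<open>k\<close>. The minus sign comes from joining two intervals.\<close>

lemma S_mult_nu:
  assumes "1 \<le> i" "i < k" "k < j" "j \<le> Suc n"
  shows "(- 1) ^ (j - Suc i) * tau D i j * (M i k * \<mu> k j) = - (S i k * \<nu> k j)"
proof (cases "M i k = 0")
  case False
  then have "tau D i j = tau D i k * tau D k j"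
    using assms by (intro tau_mult trivial_char_M) auto
  then show ?thesis
    using sign_split[of i k j] assms by (simp add: S_def \<nu>_def mult_ac)
qed (simp add: S_def)

lemma S_rec:
  assumes "1 \<le> i" "i < j" "j \<le> Suc n"
  shows "S i j = \<nu> i j - s * (\<Sum>k\<in>{Suc i..<j}. S i k * \<nu> k j)"
proof -
  have "S i j = \<nu> i j + s * (\<Sum>k\<in>{Suc i..<j}. (- 1) ^ (j - Suc i) * tau D i j * (M i k * \<mu> k j))"
    unfolding S_def \<nu>_def chain_sum_rec[OF assms(2), of s \<mu>]
    by (simp add: distrib_left sum_distrib_left mult_ac)
  also have "(\<Sum>k\<in>{Suc i..<j}. (- 1) ^ (j - Suc i) * tau D i j * (M i k * \<mu> k j))
      = (\<Sum>k\<in>{Suc i..<j}. - (S i k * \<nu> k j))"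
    using assms by (intro sum.cong refl S_mult_nu) auto
  finally show ?thesis
    by (simp add: sum_negf)
qed

text \<open>Up to the signs and \<tau>, \<open>nmat\<close> is T = 1 - s \<mu> and
  \<open>smat\<close> is its inverse 1 + s M.\<close>

definition nmat :: "nat \<Rightarrow> nat \<Rightarrow> 'k" where "nmat = unitri s \<nu>"
definition smat :: "nat \<Rightarrow> nat \<Rightarrow> 'k" where "smat = unitri (- s) S"

lemma sum_interval:
  fixes f :: "nat \<Rightarrow> 'b::comm_monoid_add"
  assumes "i \<in> {1..Suc n}" "j \<in> {1..Suc n}" "i < j"
    and "\<And>k. k < i \<Longrightarrow> f k = 0" "\<And>k. j < k \<Longrightarrow> f k = 0"
  shows "(\<Sum>k\<in>{1..Suc n}. f k) = f i + (\<Sum>k\<in>{Suc i..<j}. f k) + f j"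
proof -
  have "(\<Sum>k\<in>{1..Suc n}. f k) = (\<Sum>k\<in>{i..j}. f k)"
    using assms by (intro sum.mono_neutral_right) force+
  also have "{i..j} = insert i (insert j {Suc i..<j})"
    using assms by auto
  also have "sum f \<dots> = f i + (\<Sum>k\<in>{Suc i..<j}. f k) + f j"
    using assms by (simp add: add_ac)
  finally show ?thesis .
qed

text \<open>Above the diagonal this is \<open>S_rec\<close> multiplied by \<open>s\<close>.\<close>

lemma smat_nmat:
  assumes "i \<in> {1..Suc n}" "j \<in> {1..Suc n}"
  shows "(\<Sum>k\<in>{1..Suc n}. smat i k * nmat k j) = (if i = j then 1 else 0)"
proof (cases "i < j")
  case True
  have "(\<Sum>k\<in>{1..Suc n}. smat i k * nmat k j) = nmat i j + (\<Sum>k\<in>{Suc i..<j}. smat i k * nmat k j) + smat i j"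
    using assms True by (subst sum_interval) (auto simp: smat_def nmat_def unitri_def)
  also have "(\<Sum>k\<in>{Suc i..<j}. smat i k * nmat k j) = - (s * (s * (\<Sum>k\<in>{Suc i..<j}. S i k * \<nu> k j)))"
    unfolding sum_distrib_left sum_negf[symmetric] by (intro sum.cong refl) (auto simp: smat_def nmat_def unitri_def)
  also have "nmat i j + \<dots> + smat i j = 0"
    using True assms by (simp add: smat_def nmat_def unitri_def S_rec[of i j] right_diff_distrib)
  finally show ?thesis
    using True by simp
next
  case False
  have "(\<Sum>k\<in>{1..Suc n}. smat i k * nmat k j) = (\<Sum>k\<in>{1..Suc n}. if k = i then nmat i j else 0)"
    using False by (intro sum.cong refl) (auto simp: smat_def nmat_def unitri_def)
  also have "\<dots> = nmat i j"
    using assms by simp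
  also have "\<dots> = (if i = j then 1 else 0)"
    using False by (simp add: nmat_def unitri_def)
  finally show ?thesis .
qed

lemma nmat_smat:
  assumes "i \<in> {1..Suc n}" "j \<in> {1..Suc n}"
  shows "(\<Sum>k\<in>{1..Suc n}. nmat i k * smat k j) = (if i = j then 1 else 0)"
  by (rule unitri_right_inverse[OF _ _ smat_nmat assms]) (auto simp: smat_def unitri_def)

section \<open>The values of \<sigma>(\<mu>) and the involution\<close>

abbreviation "\<sigma> \<equiv> sigma_fam n D \<mu>"

lemma sigma_fam_tilde:
  assumes "1 \<le> i" "i < j" "j \<le> Suc n"
  shows "\<sigma> (tilde n j) (tilde n i) = S i j"
proof -
  have "(\<Sum>c\<in>chains (tilde n j) (tilde n i). (par D - 1) ^ (N * (length c - 2)) * chain_prod \<mu> (rev (map (tilde n) c))) = M i j"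
    using assms chain_sum_tilde[of i n j s \<mu>] by (simp add: s_def power_mult)
  \<comment> \<open>The sign exponent in \<open>sigma_fam\<close> exceeds the one in
    \<open>S\<close> by 2.\<close>
  moreover have "tilde n i - tilde n j + 1 = Suc (Suc (j - Suc i))"
    using assms by (simp add: tilde_def)
  ultimately show ?thesis
    using assms by (simp add: sigma_fam_def S_def tilde_tilde)
qed

lemma sum_tilde:
  assumes "1 \<le> i" "i < j" "j \<le> Suc n"
  shows "(\<Sum>k\<in>{Suc (tilde n j)..<tilde n i}. f k) = (\<Sum>k\<in>{Suc i..<j}. f (tilde n k))"
  using assms by (intro sum.reindex_bij_witness[of _ "tilde n" "tilde n"]) (auto simp: tilde_def)

text \<open>After reflection the last step of a chain becomes the step from \<open>i\<close> to
  \<open>k\<close>, so the recursion for chain sums of \<sigma>(\<mu>) is \<open>S_rec\<close>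
  solved for \<nu>. Here \<open>j\<close> stays fixed and \<open>i\<close> varies.\<close>

lemma chain_sum_sigma:
  assumes "1 \<le> i" "i < j" "j \<le> Suc n"
  shows "chain_sum s \<sigma> (tilde n j) (tilde n i) = \<nu> i j"
  using assms
proof (induction "j - i" arbitrary: i rule: less_induct)
  case less
  have "chain_sum s \<sigma> (tilde n j) (tilde n i) = \<sigma> (tilde n j) (tilde n i)
      + s * (\<Sum>k\<in>{Suc i..<j}. chain_sum s \<sigma> (tilde n j) (tilde n k) * \<sigma> (tilde n k) (tilde n i))"
    using less.prems by (subst chain_sum_rec) (auto simp: sum_tilde, simp add: tilde_def)
  also have "\<dots> = S i j + s * (\<Sum>k\<in>{Suc i..<j}. S i k * \<nu> k j)"
    using less by (auto intro!: arg_cong2[of _ _ _ _ "(+)"] sum.cong simp: sigma_fam_tilde mult.commute)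
  also have "\<dots> = \<nu> i j"
    using less.prems by (simp add: S_rec[of i j])
  finally show ?case .
qed

lemma sigma_datum_sel [simp]:
  "grp (sigma_datum n D) = grp D" "par (sigma_datum n D) = par D" "ordr (sigma_datum n D) = N"
  by (simp_all add: sigma_datum_def)

text \<open>The flip exchanges the two indices of each q_lk, so the product pairs q_kl^N with
  q_lk^N.\<close>

lemma tau_sigma_datum:
  assumes "1 \<le> i" "i < j" "j \<le> Suc n"
  shows "tau (sigma_datum n D) (tilde n j) (tilde n i) * tau D i j = 1"
proof -
  have "tau (sigma_datum n D) (tilde n j) (tilde n i) = (\<Prod>(k, l)\<in>{(k, l). i \<le> k \<and> k < l \<and> l < j}. qq D k l ^ N)"
    unfolding tau_def
    by (rule prod.reindex_bij_witness[of _ "\<lambda>(k, l). (Suc n - l, Suc n - k)" "\<lambda>(k, l). (Suc n - l, Suc n - k)"])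
      (use assms in \<open>auto simp: tilde_def qq_def sigma_datum_def\<close>)
  then have "tau (sigma_datum n D) (tilde n j) (tilde n i) * tau D i j
      = (\<Prod>(k, l)\<in>{(k, l). i \<le> k \<and> k < l \<and> l < j}. qq D k l ^ N * qq D l k ^ N)"
    by (simp add: tau_def prod.distrib[symmetric] split_def)
  also have "\<dots> = 1"
    using assms by (intro prod.neutral) (auto intro!: qq_pow)
  finally show ?thesis .
qed

text \<open>The chain sum occurring in the second application is \<nu>; its sign squares away and
  its \<tau> is cancelled by that of the reflected datum.\<close>

theorem sigma_fam_sigma_fam:
  assumes "1 \<le> i" "i < j" "j \<le> Suc n"
  shows "sigma_fam n (sigma_datum n D) \<sigma> i j = \<mu> i j"
proof -
  have *: "tilde n (tilde n i) = i" "tilde n (tilde n j) = j" "tilde n i \<le> n + 2" "tilde n j \<le> n + 2"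
    using assms by (auto simp: tilde_def)
  have "(\<Sum>c\<in>chains i j. (par D - 1) ^ (N * (length c - 2)) * chain_prod \<sigma> (rev (map (tilde n) c))) = \<nu> i j"
    using chain_sum_tilde[OF *(4,3), of s \<sigma>] chain_sum_sigma[OF assms]
    by (simp add: * s_def power_mult)
  then have "sigma_fam n (sigma_datum n D) \<sigma> i j
      = tau (sigma_datum n D) (tilde n j) (tilde n i) * (- 1) ^ (j - i + 1) * \<nu> i j"
    by (simp add: sigma_fam_def)
  also have "(- 1 :: 'k) ^ (j - i + 1) = (- 1) ^ (j - Suc i)"
    using assms by (simp flip: Suc_diff_Suc)
  also have "tau (sigma_datum n D) (tilde n j) (tilde n i) * (- 1) ^ (j - Suc i) * \<nu> i j
      = (tau (sigma_datum n D) (tilde n j) (tilde n i) * tau D i j) * \<mu> i j"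
    by (simp add: \<nu>_def mult_ac flip: power_add power_mult_distrib)
  finally show ?thesis
    by (simp add: tau_sigma_datum[OF assms])
qed

text \<open>The flip carries the characters of the reflected datum to those of \<open>D\<close>, and
  where chi_ij^N is non-trivial \<open>trivial_char_M\<close> forces the chain sum to
  vanish.\<close>

theorem R2_sigma_fam: "R2 n (sigma_datum n D) \<sigma>"
  unfolding R2_def
proof (intro allI impI)
  fix a b
  assume ab: "1 \<le> a \<and> a < b \<and> b \<le> n + 1 \<and>
    \<not> (\<forall>h\<in>carrier (grp (sigma_datum n D)). chr_root (sigma_datum n D) a b h ^ ordr (sigma_datum n D) = 1)"
  define i j where "i = tilde n b" and "j = tilde n a"
  have ij: "1 \<le> i" "i < j" "j \<le> Suc n" "tilde n j = a" "tilde n i = b"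
    using ab by (auto simp: i_def j_def tilde_def)
  have "chr_root (sigma_datum n D) a b h = chr_root D i j h" for h
    unfolding chr_root_def
    by (rule prod.reindex_bij_witness[of _ "\<lambda>l. Suc n - l" "\<lambda>l. Suc n - l"])
      (use ab in \<open>auto simp: i_def j_def tilde_def sigma_datum_def\<close>)
  then have "\<not> trivial_char i j"
    using ab by (simp add: trivial_char_def)
  then have "M i j = 0"
    using trivial_char_M ij by blast
  then show "\<sigma> a b = 0"
    using sigma_fam_tilde[OF ij(1-3)] by (simp add: ij S_def)
qed

end

section \<open>Quotients of free algebras\<close>

lemma poly_mapping_sum_singles:
  "p = (\<Sum>w\<in>Poly_Mapping.keys p. Poly_Mapping.single w (Poly_Mapping.lookup p w))"
proof (rule poly_mapping_eqI)
  fix k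
  have "(\<Sum>w\<in>Poly_Mapping.keys p. Poly_Mapping.lookup p w when w = k) = Poly_Mapping.lookup p k"
    by (cases "k \<in> Poly_Mapping.keys p") (auto simp: when_def in_keys_iff)
  then show "Poly_Mapping.lookup p k = Poly_Mapping.lookup (\<Sum>w\<in>Poly_Mapping.keys p. Poly_Mapping.single w (Poly_Mapping.lookup p w)) k"
    by (simp add: lookup_sum lookup_single)
qed

lemma scal_commute: "scal c * p = p * scal (c :: 'k::field)"
proof -
  have "scal c * (\<Sum>w\<in>Poly_Mapping.keys p. Poly_Mapping.single w (Poly_Mapping.lookup p w))
      = (\<Sum>w\<in>Poly_Mapping.keys p. Poly_Mapping.single w (Poly_Mapping.lookup p w)) * scal c"
    by (simp add: sum_distrib_left sum_distrib_right mult_single mult.commute)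
  then show ?thesis
    by (simp flip: poly_mapping_sum_singles)
qed

text \<open>
  Killing the letters outside \<open>X\<close> is a retraction onto the free algebra on \<open>X\<close>; it turns an ideal
  of that subring into an ideal of the whole type.
\<close>

definition restrict_letters :: "'x set \<Rightarrow> ('x word \<Rightarrow>\<^sub>0 'k::field) \<Rightarrow> ('x word \<Rightarrow>\<^sub>0 'k)" where
  "restrict_letters X p = Poly_Mapping.mapp (\<lambda>w c. if set (letters w) \<subseteq> X then c else 0) p"

lemma lookup_restrict_letters:
  "Poly_Mapping.lookup (restrict_letters X p) w = (if set (letters w) \<subseteq> X then Poly_Mapping.lookup p w else 0)"
  by (simp add: restrict_letters_def lookup_mapp when_def in_keys_iff)

lemma restrict_letters_add: "restrict_letters X (p + r) = restrict_letters X p + restrict_letters X r"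
  by (rule poly_mapping_eqI) (simp add: lookup_restrict_letters lookup_add)

lemma restrict_letters_zero: "restrict_letters X 0 = 0"
  by (rule poly_mapping_eqI) (simp add: lookup_restrict_letters)

lemma restrict_letters_sum: "restrict_letters X (sum f A) = (\<Sum>a\<in>A. restrict_letters X (f a))"
  by (induction A rule: infinite_finite_induct) (simp_all add: restrict_letters_add restrict_letters_zero)

lemma restrict_letters_single:
  "restrict_letters X (Poly_Mapping.single w c) = (if set (letters w) \<subseteq> X then Poly_Mapping.single w c else 0)"
  by (rule poly_mapping_eqI) (auto simp: lookup_restrict_letters lookup_single when_def)

text \<open>A concatenation uses only letters from \<open>X\<close> exactly when both words do; the
  rest is bilinearity.\<close>

lemma restrict_letters_mult: "restrict_letters X (p * r) = restrict_letters X p * restrict_letters X r"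
proof -
  have single: "restrict_letters X (Poly_Mapping.single v c * Poly_Mapping.single w d)
      = restrict_letters X (Poly_Mapping.single v c) * restrict_letters X (Poly_Mapping.single w d)"
    for v w and c d :: 'b
    by (simp add: mult_single restrict_letters_single plus_word_def)
  let ?s = "\<lambda>p :: 'a word \<Rightarrow>\<^sub>0 'b. \<Sum>w\<in>Poly_Mapping.keys p. Poly_Mapping.single w (Poly_Mapping.lookup p w)"
  have "restrict_letters X (?s p * ?s r) = restrict_letters X (?s p) * restrict_letters X (?s r)"
    by (simp add: sum_product restrict_letters_sum single)
  then show ?thesis
    by (simp flip: poly_mapping_sum_singles)
qed

lemma restrict_letters_in: "restrict_letters X p \<in> carrier (free_algebra X)"
  by (auto simp: carrier_free_algebra in_keys_iff lookup_restrict_letters split: if_splits)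

lemma restrict_letters_id: "p \<in> carrier (free_algebra X) \<Longrightarrow> restrict_letters X p = p"
  by (rule poly_mapping_eqI) (auto simp: carrier_free_algebra in_keys_iff lookup_restrict_letters)

definition scale :: "'k::field \<Rightarrow> ('x word \<Rightarrow>\<^sub>0 'k) \<Rightarrow> ('x word \<Rightarrow>\<^sub>0 'k)" where
  "scale c p = scal c * p"

lemma scal_mult: "scal c * scal d = scal (c * d :: 'k::field)"
  by (simp add: mult_single)

lemma algebra_ideal_restrict_letters:
  assumes "ideal J (free_algebra X)"
  shows "algebra_ideal scale {p. restrict_letters X p \<in> J}"
proof -
  interpret J: ideal J "free_algebra X"
    by fact
  show ?thesis
  proof (unfold_locales, goal_cases)
    case (1 c p r) then show ?case by (simp add: scale_def distrib_left)
  next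
    case (2 c d p) then show ?case by (simp add: scale_def single_add distrib_right)
  next
    case (3 c d p) then show ?case by (simp add: scale_def flip: scal_mult mult.assoc)
  next
    case (4 p) then show ?case by (simp add: scale_def)
  next
    case (5 c p r) then show ?case by (simp add: scale_def mult.assoc)
  next
    case (6 p c r) then show ?case by (simp add: scale_def scal_commute[of c] mult.assoc)
  next
    case 7 then show ?case using additive_subgroup.zero_closed[OF J.is_additive_subgroup] by (simp add: restrict_letters_zero)
  next
    case (8 p r) then show ?case
      using additive_subgroup.a_closed[OF J.is_additive_subgroup, of "restrict_letters X p" "restrict_letters X r"]
      by (simp add: restrict_letters_add)
  next
    case (9 p r) then show ?case
      using J.I_l_closed[OF _ restrict_letters_in] by (simp add: restrict_letters_mult)
  next
    case (10 p r) then show ?case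
      using J.I_r_closed[OF _ restrict_letters_in] by (simp add: restrict_letters_mult)
  qed
qed

section \<open>The group algebra and the braided adjoint action\<close>

lemma of_group_algebra_superset:
  assumes "finite A" "Poly_Mapping.keys p \<subseteq> A"
  shows "of_group_algebra p = (\<Sum>h\<in>A. scale (Poly_Mapping.lookup p h) (grp_gen h))"
  unfolding of_group_algebra_def scale_def
  using assms by (intro sum.mono_neutral_left) (auto simp: in_keys_iff)

lemma of_group_algebra_add: "of_group_algebra (p + r) = of_group_algebra p + of_group_algebra r"
proof -
  let ?A = "Poly_Mapping.keys p \<union> Poly_Mapping.keys r"
  have "Poly_Mapping.keys (p + r) \<subseteq> ?A"
    by (rule keys_add)
  then show ?thesis
    by (simp add: of_group_algebra_superset[of ?A] lookup_add scale_def single_add distrib_right sum.distrib)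
qed

lemma of_group_algebra_single: "of_group_algebra (Poly_Mapping.single h c) = scale c (grp_gen h)"
  by (simp add: of_group_algebra_def scale_def)

lemma of_group_algebra_zero: "of_group_algebra 0 = 0"
  by (simp add: of_group_algebra_def)

lemma of_group_algebra_diff: "of_group_algebra (p - r) = of_group_algebra p - of_group_algebra r"
  using of_group_algebra_add[of "p - r" r] by simp

lemma of_group_algebra_sum: "of_group_algebra (sum f A) = (\<Sum>a\<in>A. of_group_algebra (f a))"
  by (induction A rule: infinite_finite_induct) (simp_all add: of_group_algebra_add of_group_algebra_zero)

text \<open>\<open>ad_c\<close> weights every word separately; on elements all of whose words have
  the same weight it is a braided commutator.\<close>

lemma ad_c_homogeneous:
  assumes "\<And>v. v \<in> Poly_Mapping.keys p \<Longrightarrow> braiding D i v = b"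
  shows "ad_c D i p = var_gen i * p - scale b (p * var_gen i)"
proof -
  have "ad_c D i p = (\<Sum>v\<in>Poly_Mapping.keys p. var_gen i * Poly_Mapping.single v (Poly_Mapping.lookup p v)
      - scal b * Poly_Mapping.single v (Poly_Mapping.lookup p v) * var_gen i)"
    unfolding ad_c_def
  proof (intro sum.cong refl)
    fix v assume v: "v \<in> Poly_Mapping.keys p"
    have "Poly_Mapping.single v (Poly_Mapping.lookup p v) = scal (Poly_Mapping.lookup p v) * Poly_Mapping.single v 1"
      by (simp add: mult_single)
    then show "scal (Poly_Mapping.lookup p v) * (var_gen i * Poly_Mapping.single v 1
        - scal (braiding D i v) * Poly_Mapping.single v 1 * var_gen i)
      = var_gen i * Poly_Mapping.single v (Poly_Mapping.lookup p v)
        - scal b * Poly_Mapping.single v (Poly_Mapping.lookup p v) * var_gen i"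
      using assms[OF v]
      by (simp add: mult_single right_diff_distrib mult.commute flip: mult.assoc)
  qed
  also have "\<dots> = var_gen i * p - scal b * p * var_gen i"
    by (simp add: sum_subtractf flip: sum_distrib_left sum_distrib_right poly_mapping_sum_singles)
  finally show ?thesis
    by (simp add: scale_def mult.assoc)
qed

section \<open>The algebra \<open>u(\<D>, \<mu>)\<close>\<close>

context datum_family
begin

text \<open>The ideal of relations pulled back along the retraction, so that congruence makes sense
  on the whole type.\<close>

definition kern :: "('g gen word \<Rightarrow>\<^sub>0 'k) set" where
  "kern = {p. restrict_letters (gens n D) p \<in> rel_ideal n D \<mu>}"

sublocale alg: algebra_ideal scale kern
  unfolding kern_def by (rule algebra_ideal_restrict_letters[OF ideal_rel_ideal[OF datum]])

notation alg.eqv (infix "\<approx>" 50)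

lemma relator_kern:
  assumes "r \<in> relators n D \<mu>"
  shows "r \<in> kern"
proof -
  have "r \<in> carrier (free_algebra (gens n D))" "r \<in> rel_ideal n D \<mu>"
    using assms relators_in[OF datum, of \<mu>] ring.genideal_self[OF ring_free_algebra relators_in[OF datum, of \<mu>]]
    by (auto simp: rel_ideal_def)
  then show ?thesis
    by (simp add: kern_def restrict_letters_id)
qed

text \<open>On the free algebra over \<open>gens n D\<close> the retraction is the identity, so
  congruence there is equality of cosets.\<close>

lemma eqv_u_class:
  assumes "p \<approx> r" and p: "p \<in> carrier (free_algebra (gens n D))" and r: "r \<in> carrier (free_algebra (gens n D))"
  shows "u_class n D \<mu> p = u_class n D \<mu> r"
proof -
  interpret fr: ring "free_algebra (gens n D)"
    by (rule ring_free_algebra)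
  have "\<ominus>\<^bsub>free_algebra (gens n D)\<^esub> r = - r"
    by (rule fr.minus_equality) (use r in \<open>auto intro: free_algebra_uminus\<close>)
  then have "p \<ominus>\<^bsub>free_algebra (gens n D)\<^esub> r = p - r"
    by (simp add: a_minus_def)
  moreover have "p - r \<in> kern"
    using assms(1) by (simp add: alg.eqv_def)
  then have "p - r \<in> rel_ideal n D \<mu>"
    using p r by (simp add: kern_def restrict_letters_id free_algebra_diff)
  ultimately show ?thesis
    using fr.quotient_eq_iff_same_a_r_cos[OF ideal_rel_ideal[OF datum] p r] by (simp add: u_class_def)
qed

lemma u_class_power:
  assumes "p \<in> carrier (free_algebra (gens n D))"
  shows "u_class n D \<mu> (p ^ l) = u_class n D \<mu> p [^]\<^bsub>u_alg n D \<mu>\<^esub> l"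
proof -
  note hom = u_class_hom[OF datum, of \<mu>]
  interpret ring "u_alg n D \<mu>"
    unfolding u_alg_def by (rule ideal.quotient_is_ring[OF ideal_rel_ideal[OF datum]])
  show ?thesis
  proof (induction l)
    case 0
    then show ?case
      using ring_hom_one[OF hom] by simp
  next
    case (Suc l)
    have "u_class n D \<mu> (p ^ l * p) = u_class n D \<mu> (p ^ l) \<otimes>\<^bsub>u_alg n D \<mu>\<^esub> u_class n D \<mu> p"
      using ring_hom_mult[OF hom free_algebra_power[OF assms] assms] by simp
    then show ?case
      by (simp add: Suc power_Suc2 del: power_Suc)
  qed
qed

lemma ad_c_var: "ad_c D i (var_gen j) = alg.br (qq D i j) (var_gen i) (var_gen j)"
  by (subst ad_c_homogeneous[of _ D i "qq D i j"]) (auto simp: alg.br_def braiding_def split: if_splits)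

text \<open>Both words of the inner bracket, x_i x_j and x_j x_i, have weight q_ii q_ij.\<close>

lemma ad_c_var_twice:
  "ad_c D i (ad_c D i (var_gen j)) = alg.br (qq D i i * qq D i j) (var_gen i) (alg.br (qq D i j) (var_gen i) (var_gen j))"
proof -
  have "alg.br (qq D i j) (var_gen i) (var_gen j)
      = Poly_Mapping.single (Word [Var i, Var j]) 1 - Poly_Mapping.single (Word [Var j, Var i]) (qq D i j)"
    by (simp add: alg.br_def scale_def mult_single plus_word_def zero_word_def)
  then have "Poly_Mapping.keys (alg.br (qq D i j) (var_gen i) (var_gen j)) \<subseteq> {Word [Var i, Var j], Word [Var j, Var i]}"
    using keys_diff[of "Poly_Mapping.single (Word [Var i, Var j]) 1" "Poly_Mapping.single (Word [Var j, Var i]) (qq D i j)"]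
    by (auto split: if_splits)
  then have "braiding D i v = qq D i i * qq D i j" if "v \<in> Poly_Mapping.keys (alg.br (qq D i j) (var_gen i) (var_gen j))" for v
    using that by (auto simp: braiding_def mult.commute)
  then show ?thesis
    unfolding ad_c_var by (subst ad_c_homogeneous) (auto simp: alg.br_def)
qed

lemma serre_relator:
  "i \<in> {1..n} \<Longrightarrow> j \<in> {1..n} \<Longrightarrow> i \<noteq> j \<Longrightarrow> (ad_c D i ^^ nat (1 - cartan_matrix i j)) (var_gen j) \<in> kern"
  by (intro relator_kern) (auto simp: relators_def simp del: atLeastAtMost_iff)

sublocale qa: type_A_algebra scale kern n var_gen "qq D" "par D"
proof (unfold_locales, goal_cases)
  case (1 i) then show ?case by (rule qq_diag)
next
  case (2 i j) then show ?case using qq_adj[of i j] par_nonzero by simp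
next
  case (3 i j) then show ?case by (rule qq_far)
next
  case 4 then show ?case by (rule one_plus_par)
next
  case (5 i j)
  then have "cartan_matrix i j = 0"
    by (auto simp: cartan_matrix_def)
  then show ?case
    using serre_relator[of i j] 5 by (auto simp: alg.qcomm_def ad_c_var)
next
  case (6 i j)
  then have "cartan_matrix i j = - 1"
    by (auto simp: cartan_matrix_def)
  then have "ad_c D i (ad_c D i (var_gen j)) \<in> kern"
    using serre_relator[of i j] 6 by (auto simp: numeral_2_eq_2)
  then show ?case
    using 6 by (simp add: alg.qcomm_def ad_c_var_twice qq_diag del: atLeastAtMost_iff)
qed

lemma root_vec_eq: "root_vec D i j = qa.root i j"
proof (induction i j rule: qa.root.induct)
  case (1 i j)
  show ?case
  proof (cases "j \<le> Suc i")
    case False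
    have "chr_root D (Suc i) j (elt D i) = qa.bichar i (Suc i) (Suc i) j"
      by (simp add: qa.bichar_def chr_root_def qq_def)
    then show ?thesis
      using 1 False by (subst root_vec.simps) (simp add: qa.root_step alg.br_def alg.scl_mult mult.assoc flip: scale_def)
  qed (simp add: root_vec.simps qa.root.simps)
qed

lemma rev_root_vec_eq: "rev_root_vec D j i = qa.rroot j i"
proof (induction j i rule: qa.rroot.induct)
  case (1 j i)
  show ?case
  proof (cases "j \<le> Suc i")
    case False
    then obtain l where l: "j = Suc l" "i < l"
      by (cases j) auto
    have "chr_root D i l (elt D l) = qa.bichar l (Suc l) i l"
      by (simp add: qa.bichar_def chr_root_def qq_def)
    then show ?thesis
      using 1 False l by (subst rev_root_vec.simps) (simp add: qa.rroot_step alg.br_def alg.scl_mult mult.assoc flip: scale_def)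
  qed (simp add: rev_root_vec.simps qa.rroot.simps)
qed

text \<open>The one additional factor in \<open>tau_prod\<close>, at l = i, is an empty
  product.\<close>

lemma twist_eq: "i < j \<Longrightarrow> qa.twist N i j = tau D i j"
  unfolding tau_prod
  by (subst prod.atLeast_Suc_lessThan) (simp_all add: qa.twist_def qa.bichar_def prod_power_distrib)

section \<open>Matrices over the group algebra\<close>

definition H :: "nat \<Rightarrow> nat \<Rightarrow> ('g gen word \<Rightarrow>\<^sub>0 'k)" where
  "H i j = grp_gen (elt_root D i j [^]\<^bsub>grp D\<^esub> N)"

lemma grp_gen_one: "grp_gen \<one>\<^bsub>grp D\<^esub> \<approx> 1"
  unfolding alg.eqv_def by (rule relator_kern) (simp add: relators_def)

lemma grp_gen_mult:
  "g \<in> carrier (grp D) \<Longrightarrow> h \<in> carrier (grp D) \<Longrightarrow> grp_gen g * grp_gen h \<approx> grp_gen (g \<otimes>\<^bsub>grp D\<^esub> h)"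
  unfolding alg.eqv_def by (rule relator_kern) (unfold relators_def, blast)

lemma H_refl: "H i i \<approx> 1"
  using grp_gen_one by (simp add: H_def elt_root_def)

lemma H_trans:
  assumes "1 \<le> i" "i \<le> k" "k \<le> j" "j \<le> Suc n"
  shows "H k j * H i k \<approx> H i j"
proof -
  let ?a = "elt_root D i k" and ?b = "elt_root D k j"
  have c: "?a \<in> carrier (grp D)" "?b \<in> carrier (grp D)"
    using assms by auto
  have "elt_root D i j [^]\<^bsub>grp D\<^esub> N = ?b [^]\<^bsub>grp D\<^esub> N \<otimes>\<^bsub>grp D\<^esub> ?a [^]\<^bsub>grp D\<^esub> N"
    using c assms by (simp add: elt_root_concat[of i k j] grp.nat_pow_distrib grp.m_comm)
  then show ?thesis
    using c grp_gen_mult[of "?b [^]\<^bsub>grp D\<^esub> N" "?a [^]\<^bsub>grp D\<^esub> N"] by (simp add: H_def)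
qed

text \<open>Let G be diagonal with entries g_1i^N, so that H i j stands for G_i^-1 G_j. Then
  \<open>Y\<close> is \<open>smat\<close> G^-1 \<open>nmat\<close> G, the twisted form of 1 + s
  u(\<mu>), and \<open>Z\<close> is G^-1 \<open>smat\<close> G \<open>nmat\<close>.\<close>

definition Y :: "nat \<Rightarrow> nat \<Rightarrow> ('g gen word \<Rightarrow>\<^sub>0 'k)" where
  "Y i j = (\<Sum>k\<in>{1..Suc n}. scale (smat i k * nmat k j) (H k j))"

definition Z :: "nat \<Rightarrow> nat \<Rightarrow> ('g gen word \<Rightarrow>\<^sub>0 'k)" where
  "Z i j = (\<Sum>k\<in>{1..Suc n}. scale (smat i k * nmat k j) (H i k))"

lemma smat_nmat_zero: "\<not> (i \<le> k \<and> k \<le> j) \<Longrightarrow> smat i k * nmat k j = 0"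
  by (auto simp: smat_def nmat_def unitri_def)

lemma smat_diag [simp]: "smat i i = 1" and nmat_diag [simp]: "nmat i i = 1"
  by (simp_all add: smat_def nmat_def unitri_def)

lemma Y_zero: "j < i \<Longrightarrow> Y i j = 0" and Z_zero: "j < i \<Longrightarrow> Z i j = 0"
  unfolding Y_def Z_def by (auto intro!: sum.neutral simp: smat_nmat_zero alg.scl_zero_left)

lemma sum_diag:
  fixes f :: "nat \<Rightarrow> ('g gen word \<Rightarrow>\<^sub>0 'k)"
  assumes "i \<in> {1..Suc n}"
  shows "(\<Sum>k\<in>{1..Suc n}. scale (smat i k * nmat k i) (f k)) = f i"
proof -
  have "(\<Sum>k\<in>{1..Suc n}. scale (smat i k * nmat k i) (f k)) = (\<Sum>k\<in>{1..Suc n}. if k = i then f i else 0)"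
    by (intro sum.cong refl) (auto simp: smat_nmat_zero alg.scl_zero_left alg.scl_one)
  then show ?thesis
    using assms by simp
qed

lemma Y_diag: "i \<in> {1..Suc n} \<Longrightarrow> Y i i \<approx> 1" and Z_diag: "i \<in> {1..Suc n} \<Longrightarrow> Z i i \<approx> 1"
  unfolding Y_def Z_def using H_refl by (simp_all only: sum_diag)

lemma sum_rotate:
  fixes f :: "nat \<Rightarrow> nat \<Rightarrow> nat \<Rightarrow> 'c::comm_monoid_add"
  shows "(\<Sum>k\<in>A. \<Sum>a\<in>B. \<Sum>b\<in>C. f k a b) = (\<Sum>a\<in>B. \<Sum>b\<in>C. \<Sum>k\<in>A. f k a b)"
proof -
  have "(\<Sum>k\<in>A. \<Sum>a\<in>B. \<Sum>b\<in>C. f k a b) = (\<Sum>a\<in>B. \<Sum>k\<in>A. \<Sum>b\<in>C. f k a b)"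
    by (rule sum.swap)
  also have "\<dots> = (\<Sum>a\<in>B. \<Sum>b\<in>C. \<Sum>k\<in>A. f k a b)"
    by (rule sum.cong[OF refl]) (rule sum.swap)
  finally show ?thesis .
qed

text \<open>In matrix form Y Z = 1, since \<open>smat\<close> and \<open>nmat\<close> are mutually
  inverse and the powers of G cancel. The factors stand in the order in which
  \<open>rroot_power\<close> produces them.\<close>

lemma Z_Y_inverse:
  assumes "i \<in> {1..Suc n}" "j \<in> {1..Suc n}"
  shows "(\<Sum>k\<in>{1..Suc n}. Z k j * Y i k) \<approx> (if i = j then 1 else 0)"
proof -
  let ?A = "{1..Suc n}"
  have "(\<Sum>k\<in>?A. Z k j * Y i k)
      = (\<Sum>k\<in>?A. \<Sum>a\<in>?A. \<Sum>b\<in>?A. scale (smat i b * nmat b k * (smat k a * nmat a j)) (H k a * H b k))"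
    by (simp only: Z_def Y_def sum_product alg.scl_mult alg.mult_scl alg.scl_scl)
  also have "\<dots> \<approx> (\<Sum>k\<in>?A. \<Sum>a\<in>?A. \<Sum>b\<in>?A. scale (smat i b * nmat b k * (smat k a * nmat a j)) (H b a))"
  proof (intro alg.eqv_sum)
    fix k a b assume A: "k \<in> ?A" "a \<in> ?A" "b \<in> ?A"
    show "scale (smat i b * nmat b k * (smat k a * nmat a j)) (H k a * H b k) \<approx> scale (smat i b * nmat b k * (smat k a * nmat a j)) (H b a)"
    \<comment> \<open>Triangularity kills every other coefficient, and \<open>H_trans\<close>
      requires ordered indices.\<close>
    proof (cases "b \<le> k \<and> k \<le> a")
      case True
      then show ?thesis
        using A by (intro alg.eqv_scl H_trans) auto
    next
      case False
      then have "smat i b * nmat b k * (smat k a * nmat a j) = 0"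
        by (auto simp: smat_def nmat_def unitri_def)
      then show ?thesis
        by (simp only: alg.scl_zero_left alg.eqv_refl)
    qed
  qed
  also have "\<dots> = (\<Sum>a\<in>?A. \<Sum>b\<in>?A. \<Sum>k\<in>?A. scale (smat i b * nmat b k * (smat k a * nmat a j)) (H b a))"
    by (rule sum_rotate)
  also have "\<dots> = (\<Sum>a\<in>?A. \<Sum>b\<in>?A. if b = a then scale (smat i a * nmat a j) (H a a) else 0)"
  proof (intro sum.cong refl)
    fix a b assume ab: "a \<in> ?A" "b \<in> ?A"
    have "(\<Sum>k\<in>?A. scale (smat i b * nmat b k * (smat k a * nmat a j)) (H b a))
        = scale (smat i b * nmat a j * (\<Sum>k\<in>?A. nmat b k * smat k a)) (H b a)"
      unfolding alg.sum_scl sum_distrib_left by (intro sum.cong refl) (simp only: mult_ac)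
    then show "(\<Sum>k\<in>?A. scale (smat i b * nmat b k * (smat k a * nmat a j)) (H b a))
        = (if b = a then scale (smat i a * nmat a j) (H a a) else 0)"
      unfolding nmat_smat[OF ab(2,1)] by (cases "b = a") (simp_all add: alg.scl_zero_left)
  qed
  also have "\<dots> = (\<Sum>a\<in>?A. scale (smat i a * nmat a j) (H a a))"
    by (intro sum.cong refl) simp
  also have "\<dots> \<approx> (\<Sum>a\<in>?A. scale (smat i a * nmat a j) 1)"
    by (intro alg.eqv_sum alg.eqv_scl H_refl)
  also have "\<dots> = (if i = j then 1 else 0)"
    unfolding alg.sum_scl[symmetric] smat_nmat[OF assms]
    by (cases "i = j") (simp_all add: alg.scl_zero_left alg.scl_one)
  finally show ?thesis .
qed

section \<open>The elements u_ij as matrix entries\<close>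

lemma of_group_algebra_u_elem:
  assumes "i < j"
  shows "of_group_algebra (u_elem D \<mu> i j)
    = (\<Sum>k\<in>{i..<j}. scale (unitri s M i k * \<mu> k j) (grp_gen \<one>\<^bsub>grp D\<^esub> - H k j))"
  unfolding u_elem_unitri[OF assms] of_group_algebra_sum of_group_algebra_diff of_group_algebra_single
  by (simp add: H_def s_def alg.scl_diff)

lemma root_power:
  assumes "1 \<le> i" "i < j" "j \<le> Suc n"
  shows "qa.root i j ^ N \<approx> of_group_algebra (u_elem D \<mu> i j)"
  unfolding alg.eqv_def
proof (rule relator_kern)
  have "root_vec D i j ^ N - of_group_algebra (u_elem D \<mu> i j) \<in> relators n D \<mu>"
    unfolding relators_def using assms by auto
  then show "qa.root i j ^ N - of_group_algebra (u_elem D \<mu> i j) \<in> relators n D \<mu>"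
    by (simp add: root_vec_eq)
qed

text \<open>For k > i the twist is distributed over the two factors by \<open>S_mult_nu\<close>; k =
  i is the chain \<open>[i, j]\<close>, whose first factor is a diagonal 1.\<close>

lemma smat_nmat_coeff:
  assumes "1 \<le> i" "i \<le> k" "k < j" "j \<le> Suc n"
  shows "s * ((- 1) ^ (j - Suc i) * tau D i j) * (unitri s M i k * \<mu> k j) = smat i k * nmat k j"
proof (cases "k = i")
  case True
  then show ?thesis
    using assms by (simp add: smat_def nmat_def unitri_def \<nu>_def mult_ac)
next
  case False
  then have "s * ((- 1) ^ (j - Suc i) * tau D i j) * (unitri s M i k * \<mu> k j)
      = s * s * ((- 1) ^ (j - Suc i) * tau D i j * (M i k * \<mu> k j))"
    using assms by (simp add: unitri_def mult_ac)
  also have "\<dots> = s * s * (- (S i k * \<nu> k j))"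
    using S_mult_nu[of i k j] assms False by simp
  finally show ?thesis
    using assms False by (simp add: smat_def nmat_def unitri_def)
qed

text \<open>For i and j distinct the coefficients sum to 0, so the constant terms drop out of the
  full sum; summands outside \<open>B\<close> vanish modulo the relations. The element
  \<open>e\<close> will be the generator of the neutral element.\<close>

lemma sum_restrict:
  assumes "i \<in> {1..Suc n}" "j \<in> {1..Suc n}" "i \<noteq> j" "B \<subseteq> {1..Suc n}"
    and "\<And>k. k \<in> {1..Suc n} - B \<Longrightarrow> smat i k * nmat k j = 0 \<or> f k \<approx> 1"
    and e: "e \<approx> 1"
  shows "(\<Sum>k\<in>B. scale (smat i k * nmat k j) (e - f k)) \<approx> - (\<Sum>k\<in>{1..Suc n}. scale (smat i k * nmat k j) (f k))"
proof -
  have "(\<Sum>k\<in>B. scale (smat i k * nmat k j) (e - f k)) = (\<Sum>k\<in>{1..Suc n}. if k \<in> B then scale (smat i k * nmat k j) (e - f k) else 0)"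
    using assms(4) by (intro sum.mono_neutral_cong_left) auto
  also have "\<dots> \<approx> (\<Sum>k\<in>{1..Suc n}. scale (smat i k * nmat k j) (1 - f k))"
  proof (rule alg.eqv_sum)
    fix k assume k: "k \<in> {1..Suc n}"
    have "scale (smat i k * nmat k j) (1 - f k) \<approx> 0" if "k \<notin> B"
    proof (cases "smat i k * nmat k j = 0")
      case True
      then show ?thesis
        by (simp only: alg.scl_zero_left alg.eqv_refl)
    next
      case False
      then have "f k \<approx> 1"
        using assms(5) k that by blast
      then have "scale (smat i k * nmat k j) (1 - f k) \<approx> scale (smat i k * nmat k j) (1 - 1)"
        by (intro alg.eqv_scl alg.eqv_diff alg.eqv_refl)
      then show ?thesis
        by (simp add: alg.scl_zero_right)
    qed
    then show "(if k \<in> B then scale (smat i k * nmat k j) (e - f k) else 0) \<approx> scale (smat i k * nmat k j) (1 - f k)"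
      using e by (auto intro: alg.eqv_sym alg.eqv_scl alg.eqv_diff)
  qed
  also have "\<dots> = scale (\<Sum>k\<in>{1..Suc n}. smat i k * nmat k j) 1 - (\<Sum>k\<in>{1..Suc n}. scale (smat i k * nmat k j) (f k))"
    by (simp only: alg.scl_diff sum_subtractf alg.sum_scl)
  also have "(\<Sum>k\<in>{1..Suc n}. smat i k * nmat k j) = 0"
    using smat_nmat[OF assms(1,2)] assms(3) by simp
  finally show ?thesis
    by (simp add: alg.scl_zero_left)
qed

lemma twisted_u_elem:
  assumes "1 \<le> i" "i < j" "j \<le> Suc n"
  shows "scale (s * ((- 1) ^ (j - Suc i) * tau D i j)) (of_group_algebra (u_elem D \<mu> i j)) \<approx> - Y i j"
proof -
  have "scale (s * ((- 1) ^ (j - Suc i) * tau D i j)) (of_group_algebra (u_elem D \<mu> i j))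
      = (\<Sum>k\<in>{i..<j}. scale (smat i k * nmat k j) (grp_gen \<one>\<^bsub>grp D\<^esub> - H k j))"
    unfolding of_group_algebra_u_elem[OF assms(2)] alg.scl_sum alg.scl_scl
    using assms by (intro sum.cong refl) (simp only: smat_nmat_coeff atLeastLessThan_iff)
  also have "\<dots> \<approx> - Y i j"
    unfolding Y_def
  proof (intro sum_restrict grp_gen_one)
    fix k assume "k \<in> {1..Suc n} - {i..<j}"
    then have "k = j \<or> \<not> (i \<le> k \<and> k \<le> j)"
      by auto
    then show "smat i k * nmat k j = 0 \<or> H k j \<approx> 1"
      using smat_nmat_zero H_refl by blast
  qed (use assms in auto)
  finally show ?thesis .
qed

lemma elt_root_sigma:
  assumes "1 \<le> i" "i \<le> j" "j \<le> Suc n"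
  shows "elt_root (sigma_datum n D) (tilde n j) (tilde n i) = elt_root D i j"
proof -
  have "finprod (grp D) (elt D) ((\<lambda>l. Suc n - l) ` {tilde n j..<tilde n i})
      = finprod (grp D) (\<lambda>l. elt D (Suc n - l)) {tilde n j..<tilde n i}"
    by (rule grp.finprod_reindex) (use assms in \<open>auto simp: tilde_def inj_on_def intro!: elt_closed\<close>)
  moreover have "(\<lambda>l. Suc n - l) ` {tilde n j..<tilde n i} = {i..<j}"
  proof (intro equalityI subsetI)
    fix k assume "k \<in> {i..<j}"
    then show "k \<in> (\<lambda>l. Suc n - l) ` {tilde n j..<tilde n i}"
      using assms by (intro image_eqI[of _ _ "Suc n - k"]) (auto simp: tilde_def)
  qed (use assms in \<open>auto simp: tilde_def\<close>)
  ultimately show ?thesis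
    by (simp add: elt_root_def sigma_datum_def)
qed

text \<open>Under the reflection the chain sums of \<sigma>(\<mu>) give \<open>nmat\<close> and
  \<sigma>(\<mu>) itself gives \<open>smat\<close> with a minus sign. The equality is exact, so it
  also shows later that this element lies in the free algebra over the generators.\<close>

lemma of_group_algebra_u_elem_sigma:
  assumes "1 \<le> i" "i < j" "j \<le> Suc n"
  shows "scale s (of_group_algebra (u_elem (sigma_datum n D) \<sigma> (tilde n j) (tilde n i)))
    = - (\<Sum>k\<in>{Suc i..j}. scale (smat i k * nmat k j) (grp_gen \<one>\<^bsub>grp D\<^esub> - H i k))"
proof -
  let ?t = "tilde n"
  have lt: "?t j < ?t i"
    using assms by (auto simp: tilde_def)
  have "u_elem (sigma_datum n D) \<sigma> (?t j) (?t i) = (\<Sum>k\<in>{?t j..<?t i}.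
    Poly_Mapping.single \<one>\<^bsub>grp D\<^esub> (unitri s (chain_sum s \<sigma>) (?t j) k * \<sigma> k (?t i))
    - Poly_Mapping.single (elt_root (sigma_datum n D) k (?t i) [^]\<^bsub>grp D\<^esub> N) (unitri s (chain_sum s \<sigma>) (?t j) k * \<sigma> k (?t i)))"
    using u_elem_unitri[OF lt, of "sigma_datum n D" \<sigma>] by (simp add: s_def)
  also have "\<dots> = (\<Sum>k\<in>{Suc i..j}.
    Poly_Mapping.single \<one>\<^bsub>grp D\<^esub> (unitri s (chain_sum s \<sigma>) (?t j) (?t k) * \<sigma> (?t k) (?t i))
    - Poly_Mapping.single (elt_root (sigma_datum n D) (?t k) (?t i) [^]\<^bsub>grp D\<^esub> N) (unitri s (chain_sum s \<sigma>) (?t j) (?t k) * \<sigma> (?t k) (?t i)))"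
    by (rule sum.reindex_bij_witness[of _ ?t ?t]) (use assms in \<open>auto simp: tilde_def\<close>)
  finally have "scale s (of_group_algebra (u_elem (sigma_datum n D) \<sigma> (?t j) (?t i))) = (\<Sum>k\<in>{Suc i..j}.
     scale (s * (unitri s (chain_sum s \<sigma>) (?t j) (?t k) * \<sigma> (?t k) (?t i)))
       (grp_gen \<one>\<^bsub>grp D\<^esub> - grp_gen (elt_root (sigma_datum n D) (?t k) (?t i) [^]\<^bsub>grp D\<^esub> N)))"
    by (simp add: of_group_algebra_sum of_group_algebra_diff of_group_algebra_single alg.scl_sum alg.scl_diff alg.scl_scl)
  also have "\<dots> = (\<Sum>k\<in>{Suc i..j}. - scale (smat i k * nmat k j) (grp_gen \<one>\<^bsub>grp D\<^esub> - H i k))"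
  proof (intro sum.cong refl)
    fix k assume k: "k \<in> {Suc i..j}"
    have 1: "unitri s (chain_sum s \<sigma>) (?t j) (?t k) = nmat k j"
      using k assms chain_sum_sigma[of k j] by (cases "k = j") (auto simp: unitri_def nmat_def tilde_def)
    have 2: "s * \<sigma> (?t k) (?t i) = - smat i k"
      using k assms sigma_fam_tilde[of i k] by (simp add: smat_def unitri_def)
    have "s * (unitri s (chain_sum s \<sigma>) (?t j) (?t k) * \<sigma> (?t k) (?t i))
        = unitri s (chain_sum s \<sigma>) (?t j) (?t k) * (s * \<sigma> (?t k) (?t i))"
      by (rule mult.left_commute)
    also have "\<dots> = - (smat i k * nmat k j)"
      unfolding 1 2 by simp
    finally have "s * (unitri s (chain_sum s \<sigma>) (?t j) (?t k) * \<sigma> (?t k) (?t i)) = - (smat i k * nmat k j)" .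
    moreover have "elt_root (sigma_datum n D) (?t k) (?t i) = elt_root D i k"
      using k assms by (intro elt_root_sigma) auto
    ultimately show "scale (s * (unitri s (chain_sum s \<sigma>) (?t j) (?t k) * \<sigma> (?t k) (?t i)))
       (grp_gen \<one>\<^bsub>grp D\<^esub> - grp_gen (elt_root (sigma_datum n D) (?t k) (?t i) [^]\<^bsub>grp D\<^esub> N))
      = - scale (smat i k * nmat k j) (grp_gen \<one>\<^bsub>grp D\<^esub> - H i k)"
      by (simp only: H_def alg.minus_scl)
  qed
  finally show ?thesis
    by (simp only: sum_negf)
qed

lemma u_elem_sigma:
  assumes "1 \<le> i" "i < j" "j \<le> Suc n"
  shows "scale s (of_group_algebra (u_elem (sigma_datum n D) \<sigma> (tilde n j) (tilde n i))) \<approx> Z i j"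
proof -
  have "(\<Sum>k\<in>{Suc i..j}. scale (smat i k * nmat k j) (grp_gen \<one>\<^bsub>grp D\<^esub> - H i k)) \<approx> - Z i j"
    unfolding Z_def
  proof (intro sum_restrict grp_gen_one)
    fix k assume "k \<in> {1..Suc n} - {Suc i..j}"
    then have "k = i \<or> \<not> (i \<le> k \<and> k \<le> j)"
      by auto
    then show "smat i k * nmat k j = 0 \<or> H i k \<approx> 1"
      using smat_nmat_zero H_refl by blast
  qed (use assms in auto)
  from alg.eqv_diff[OF alg.eqv_refl this, of 0] show ?thesis
    by (simp add: of_group_algebra_u_elem_sigma[OF assms])
qed

text \<open>(R2) makes the power of \<open>\<chi>\<^sub>k\<^sub>j(g\<^sub>i\<^sub>k)\<close> produced by the quantum plane relation invisible.\<close>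

lemma bichar_u_elem:
  assumes "1 \<le> i" "i < k" "k \<le> j" "j \<le> Suc n"
  shows "scale (qa.bichar i k k j ^ (N * l)) (of_group_algebra (u_elem D \<mu> i k)) = of_group_algebra (u_elem D \<mu> i k)"
proof (cases "trivial_char i k")
  case True
  then have "qa.bichar i k k j ^ N = 1"
    using trivial_char_qq(2)[of i k k j] assms by (simp add: qa.bichar_def prod_power_distrib)
  then show ?thesis
    by (simp add: power_mult alg.scl_one)
next
  case False
  \<comment> \<open>A non-zero summand would make chi_ia^N and chi_ak^N trivial, hence chi_ik^N as
    well.\<close>
  have "unitri s M i a * \<mu> a k = 0" if "a \<in> {i..<k}" for a
  proof (rule ccontr)
    assume "unitri s M i a * \<mu> a k \<noteq> 0"
    then have nz: "unitri s M i a \<noteq> 0" "trivial_char a k"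
      using that assms trivial_char_mu[of a k] by auto
    show False
    proof (cases "a = i")
      case False
      then have "trivial_char i a"
        using nz that assms by (intro trivial_char_M) (auto simp: unitri_def)
      then show False
        using trivial_char_trans[of i a k] nz that \<open>\<not> trivial_char i k\<close> by auto
    qed (use nz \<open>\<not> trivial_char i k\<close> in auto)
  qed
  then have "of_group_algebra (u_elem D \<mu> i k) = 0"
    unfolding of_group_algebra_u_elem[OF assms(2)] by (intro sum.neutral ballI) (simp only: alg.scl_zero_left)
  then show ?thesis
    by (simp add: alg.scl_zero_right)
qed

text \<open>Inserting x_ik^N = u_ik in \<open>rroot_power\<close> and dropping the bicharacter
  powers by \<open>bichar_u_elem\<close> expresses s x_ji^N as - Y_ij minus the sum of s x_jk^N Y_ik
  over the k strictly between. \<open>Z\<close> obeys the same recursion because Y Z = 1.\<close>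

lemma rroot_power_Z:
  assumes "1 \<le> i" "i < j" "j \<le> Suc n"
  shows "scale s (qa.rroot j i ^ N) \<approx> Z i j"
  using assms
proof (induction "j - i" arbitrary: i rule: less_induct)
  case less
  define e where "e k = (- 1) ^ (k - Suc i) * tau D i k" for k
  let ?B = "\<lambda>k. qa.bichar i k k j ^ (N * ((N - 1) div 2))"
  have root: "scale (s * e k) (qa.root i k ^ N) \<approx> - Y i k" if "i < k" "k \<le> j" for k
  proof -
    have "scale (s * e k) (qa.root i k ^ N) \<approx> scale (s * e k) (of_group_algebra (u_elem D \<mu> i k))"
      using less.prems that by (intro alg.eqv_scl root_power) auto
    also have "\<dots> \<approx> - Y i k"
      unfolding e_def using less.prems that by (intro twisted_u_elem) auto
    finally show ?thesis .
  qed
  have "qa.rroot j i ^ N \<approx> scale (e j) (qa.root i j ^ N)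
      + (\<Sum>k\<in>{Suc i..<j}. scale (e k * s * ?B k) (qa.rroot j k ^ N * qa.root i k ^ N))"
    using qa.rroot_power[OF less.prems par_pow par_order N_odd] less.prems
    by (simp add: twist_eq e_def flip: s_def)
  then have "scale s (qa.rroot j i ^ N) \<approx> scale s (scale (e j) (qa.root i j ^ N)
      + (\<Sum>k\<in>{Suc i..<j}. scale (e k * s * ?B k) (qa.rroot j k ^ N * qa.root i k ^ N)))"
    by (rule alg.eqv_scl)
  also have "\<dots> = scale (s * e j) (qa.root i j ^ N)
      + (\<Sum>k\<in>{Suc i..<j}. scale s (qa.rroot j k ^ N) * scale (?B k) (scale (s * e k) (qa.root i k ^ N)))"
    by (simp add: alg.scl_add alg.scl_sum alg.scl_scl alg.scl_mult alg.mult_scl mult_ac)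
  also have "\<dots> \<approx> - Y i j + (\<Sum>k\<in>{Suc i..<j}. Z k j * - Y i k)"
  proof (intro alg.eqv_add alg.eqv_sum alg.eqv_mult)
    show "scale (s * e j) (qa.root i j ^ N) \<approx> - Y i j"
      using less.prems by (intro root) auto
    fix k assume k: "k \<in> {Suc i..<j}"
    then show "scale s (qa.rroot j k ^ N) \<approx> Z k j"
      using less by auto
    have "scale (?B k) (scale (s * e k) (qa.root i k ^ N)) \<approx> scale (?B k) (scale (s * e k) (of_group_algebra (u_elem D \<mu> i k)))"
      using less.prems k by (intro alg.eqv_scl root_power) auto
    also have "\<dots> = scale (s * e k) (scale (?B k) (of_group_algebra (u_elem D \<mu> i k)))"
      by (simp add: alg.scl_scl mult_ac)
    also have "\<dots> = scale (s * e k) (of_group_algebra (u_elem D \<mu> i k))"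
      using less.prems k by (subst bichar_u_elem) auto
    also have "\<dots> \<approx> - Y i k"
      unfolding e_def using less.prems k by (intro twisted_u_elem) auto
    finally show "scale (?B k) (scale (s * e k) (qa.root i k ^ N)) \<approx> - Y i k" .
  qed
  \<comment> \<open>The diagonal entries are 1 modulo the relations; inserting them, together with
    Z_ij - Z_ij Y_ii, completes the sum to the full matrix product.\<close>
  also have "\<dots> \<approx> - (Z j j * Y i j) - (\<Sum>k\<in>{Suc i..<j}. Z k j * Y i k) + (Z i j - Z i j * Y i i)"
  proof -
    have "Z j j \<approx> 1" "Y i i \<approx> 1"
      using less.prems by (auto intro: Y_diag Z_diag)
    then have "Z j j * Y i j \<approx> 1 * Y i j" "Z i j * Y i i \<approx> Z i j * 1"
      by (auto simp del: mult_1_left mult_1_right intro: alg.eqv_mult)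
    from alg.eqv_add[OF this]
    have "Z j j * Y i j + Z i j * Y i i \<approx> Y i j + Z i j"
      by simp
    from alg.eqv_diff[OF alg.eqv_refl this, of "Z i j - (\<Sum>k\<in>{Suc i..<j}. Z k j * Y i k)"]
    show ?thesis
      by (simp add: sum_negf algebra_simps alg.eqv_sym)
  qed
  also have "\<dots> = Z i j - (\<Sum>k\<in>{1..Suc n}. Z k j * Y i k)"
    using less.prems by (subst sum_interval[of i j]) (auto simp: Y_zero Z_zero algebra_simps)
  also have "\<dots> \<approx> Z i j - 0"
    using Z_Y_inverse[of i j] less.prems by (intro alg.eqv_diff) auto
  finally show ?case
    by simp
qed

theorem u_class_rev_root_vec_power:
  assumes "1 \<le> i" "i < j" "j \<le> n + 1"
  shows "u_class n D \<mu> (of_group_algebra (u_elem (sigma_datum n D) \<sigma> i j)) =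
        u_class n D \<mu> (rev_root_vec D (tilde n i) (tilde n j)) [^]\<^bsub>u_alg n D \<mu>\<^esub> N"
proof -
  define a b where "a = tilde n j" and "b = tilde n i"
  have ab: "1 \<le> a" "a < b" "b \<le> Suc n" "tilde n b = i" "tilde n a = j"
    using assms by (auto simp: a_def b_def tilde_def)
  let ?u = "of_group_algebra (u_elem (sigma_datum n D) \<sigma> i j)" and ?x = "rev_root_vec D b a"
  have "scale s ?u \<approx> scale s (?x ^ N)"
    using u_elem_sigma[OF ab(1-3)] rroot_power_Z[OF ab(1-3)] alg.eqv_sym alg.eqv_trans
    unfolding rev_root_vec_eq ab by blast
  then have eqv: "?u \<approx> ?x ^ N"
    using s_nonzero by (rule alg.eqv_scl_cancel)
  have x: "?x \<in> carrier (free_algebra (gens n D))"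
    using ab by (intro rev_root_vec_in) auto
  \<comment> \<open>Membership is read off from the explicit formula for the multiple by
    \<open>s\<close>, and then \<open>s\<close> is divided out.\<close>
  have "scale s ?u \<in> carrier (free_algebra (gens n D))"
    using of_group_algebra_u_elem_sigma[OF ab(1-3)] ab
    by (auto simp: scale_def H_def intro!: free_algebra_uminus free_algebra_sum free_algebra_mult
        free_algebra_const free_algebra_diff grp_gen_in)
  then have "scal (inverse s) * scale s ?u \<in> carrier (free_algebra (gens n D))"
    by (intro free_algebra_mult free_algebra_const)
  then have "?u \<in> carrier (free_algebra (gens n D))"
    using s_nonzero by (simp add: alg.scl_scl alg.scl_one flip: scale_def)
  with x show ?thesis
    using eqv_u_class[OF eqv] free_algebra_power[OF x] by (simp add: u_class_power a_def b_def)
qed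

end

theorem theorem4p3:
  fixes n :: nat
    and D :: "('g, 'k::{alg_closed_field, field_char_0}) datum"
    and \<mu> :: "nat \<Rightarrow> nat \<Rightarrow> 'k"
  assumes "n \<ge> 2"
    and "datum_type_A n D"
    and "R2 n D \<mu>"
  shows
    "(\<forall>i j. 1 \<le> i \<and> i < j \<and> j \<le> n + 1 \<longrightarrow>
        u_class n D \<mu> (of_group_algebra (u_elem (sigma_datum n D) (sigma_fam n D \<mu>) i j)) =
        u_class n D \<mu> (rev_root_vec D (tilde n i) (tilde n j)) [^]\<^bsub>u_alg n D \<mu>\<^esub> ordr D)
     \<and> R2 n (sigma_datum n D) (sigma_fam n D \<mu>)
     \<and> (\<forall>i j. 1 \<le> i \<and> i < j \<and> j \<le> n + 1 \<longrightarrow>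
          sigma_fam n (sigma_datum n D) (sigma_fam n D \<mu>) i j = \<mu> i j)"
proof -
  interpret datum_family n D \<mu>
    using assms by unfold_locales
  show ?thesis
    using u_class_rev_root_vec_power R2_sigma_fam sigma_fam_sigma_fam by simp
qed

end
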